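(* Let $S$ be a quadratic Shannon extension of a regular local ring. The following are equivalent: (1) $S$ is coherent. (2) $S$ is a GCD domain. (3) $S$ is a finite conductor domain. (4) $S$ is a valuation domain.
   Context: For local domains $A\subseteq B$, $B$ birationally dominates $A$ if $B$ is contained in the quotient field of $A$ and $\mathfrak m_A\subseteq\mathfrak m_B$. Local quadratic transform (LQT): let $(R,\mathfrak m)$ be a Noetherian local domain and $(V,\mathfrak m_V)$ a valuation domain birationally dominating $R$. Then $\mathfrak mV=xV$ for some $x\in\mathfrak m$, and $R_1=R[\mathfrak m/x]_{\mathfrak m_V\cap R[\mathfrak m/x]}$ is the LQT of $R$ along $V$. An LQT of $R$ is an LQT of $R$ along some such $V$. Quadratic Shannon extension: if $R$ is a regular local ring with $\dim R\ge 2$, $R_0=R$, and $\{R_n\}$ is an infinite sequence of regular local rings with $\dim R_n\ge 2$ and $R_{n+1}$ an LQT of $R_n$ for each $n$, then $S=\bigcup_n R_n$ is a quadratic Shannon extension of $R$. An integral domain $D$ is a finite conductor domain if for all $a,b$ in the field of fractions of $D$ the $D$-module $aD\cap bD$ is finitely generated. A ring is coherent if every finitely generated ideal is finitely presented. An integral domain $D$ is a GCD domain if $aD\cap bD$ is a principal ideal of $D$ for all $a,b\in D$. *)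

theory Defs
  imports "HOL-Library.Extended_Nat" "HOL-Algebra.Algebra"
begin

section \<open>Local rings, Krull dimension, regular local rings\<close>

definition local_ring :: "('a, 'b) ring_scheme \<Rightarrow> bool" where
  "local_ring R \<longleftrightarrow> cring R \<and> (\<exists>!M. maximalideal M R)"

text \<open>Meaningful for local rings only.\<close>

definition max_ideal :: "('a, 'b) ring_scheme \<Rightarrow> 'a set" where
  "max_ideal R = (THE M. maximalideal M R)"

definition krull_dim :: "('a, 'b) ring_scheme \<Rightarrow> enat" where
  "krull_dim R = Sup {enat n | n. \<exists>P :: nat \<Rightarrow> 'a set.
     (\<forall>i\<le>n. primeideal (P i) R) \<and> (\<forall>i<n. P i \<subset> P (Suc i))}"

text \<open>Minimal number of generators of a finitely generated ideal.\<close>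

definition min_gens :: "('a, 'b) ring_scheme \<Rightarrow> 'a set \<Rightarrow> nat" where
  "min_gens R I = (LEAST n. \<exists>A \<subseteq> carrier R. finite A \<and> card A = n \<and> Idl\<^bsub>R\<^esub> A = I)"

definition regular_local_ring :: "('a, 'b) ring_scheme \<Rightarrow> bool" where
  "regular_local_ring R \<longleftrightarrow>
     local_ring R \<and> noetherian_ring R \<and> enat (min_gens R (max_ideal R)) = krull_dim R"

section \<open>Finitely generated and finitely presented modules, coherent rings\<close>

definition finitely_generated :: "('a, 'b) ring_scheme \<Rightarrow> ('a, 'c, 'd) module_scheme \<Rightarrow> bool" where
  "finitely_generated R M \<longleftrightarrow> module R M \<and>
     (\<exists>A \<subseteq> carrier M. finite A \<and> \<Inter>{N. submodule N R M \<and> A \<subseteq> N} = carrier M)"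

text \<open>\<open>R\<^sup>n\<close>; the fields \<open>mult\<close> and \<open>one\<close> of a module record play no role in
  the notion of a module.\<close>

definition free_module :: "('a, 'b) ring_scheme \<Rightarrow> nat \<Rightarrow> ('a, nat \<Rightarrow> 'a) module" where
  "free_module R n =
     \<lparr> carrier = {..<n} \<rightarrow>\<^sub>E carrier R,
       monoid.mult = undefined, one = undefined,
       ring.zero = (\<lambda>i\<in>{..<n}. \<zero>\<^bsub>R\<^esub>),
       ring.add = (\<lambda>v w. \<lambda>i\<in>{..<n}. v i \<oplus>\<^bsub>R\<^esub> w i),
       smult = (\<lambda>r v. \<lambda>i\<in>{..<n}. r \<otimes>\<^bsub>R\<^esub> v i) \<rparr>"

definition module_hom ::
  "('a, 'b) ring_scheme \<Rightarrow> ('a, 'c, 'd) module_scheme \<Rightarrow> ('a, 'e, 'f) module_scheme \<Rightarrow> ('c \<Rightarrow> 'e) set" where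
  "module_hom R M N = {f \<in> hom (add_monoid M) (add_monoid N).
     \<forall>r \<in> carrier R. \<forall>x \<in> carrier M. f (r \<odot>\<^bsub>M\<^esub> x) = r \<odot>\<^bsub>N\<^esub> f x}"

definition finitely_presented :: "('a, 'b) ring_scheme \<Rightarrow> ('a, 'c, 'd) module_scheme \<Rightarrow> bool" where
  "finitely_presented R M \<longleftrightarrow> module R M \<and>
     (\<exists>n. \<exists>f \<in> module_hom R (free_module R n) M.
        f ` carrier (free_module R n) = carrier M \<and>
        finitely_generated R ((free_module R n) \<lparr> carrier := a_kernel (free_module R n) M f \<rparr>))"

text \<open>A subset \<open>B\<close> of a ring \<open>A\<close>, with the operations inherited from \<open>A\<close>,
  as a module over a subring of \<open>A\<close> (in particular, an ideal of \<open>A\<close> as a module over \<open>A\<close>).\<close>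

definition sub_as_module :: "('a, 'b) ring_scheme \<Rightarrow> 'a set \<Rightarrow> ('a, 'a) module" where
  "sub_as_module A B =
     \<lparr> carrier = B, monoid.mult = monoid.mult A, one = \<one>\<^bsub>A\<^esub>,
       ring.zero = \<zero>\<^bsub>A\<^esub>, ring.add = ring.add A,
       smult = monoid.mult A \<rparr>"

definition coherent_ring :: "('a, 'b) ring_scheme \<Rightarrow> bool" where
  "coherent_ring R \<longleftrightarrow> cring R \<and>
     (\<forall>I. ideal I R \<and> finitely_generated R (sub_as_module R I)
        \<longrightarrow> finitely_presented R (sub_as_module R I))"

section \<open>GCD domains, finite conductor domains, valuation domains\<close>

definition gcd_domain :: "('a, 'b) ring_scheme \<Rightarrow> bool" where
  "gcd_domain D \<longleftrightarrow> domain D \<and>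
     (\<forall>a \<in> carrier D. \<forall>b \<in> carrier D. principalideal (PIdl\<^bsub>D\<^esub> a \<inter> PIdl\<^bsub>D\<^esub> b) D)"

text \<open>From here on, domains are subrings of an ambient field \<open>F\<close>, and the quotient field of a
  domain is formed inside \<open>F\<close>. It need not be all of \<open>F\<close>.\<close>

definition quotient_field :: "('a, 'b) ring_scheme \<Rightarrow> 'a set \<Rightarrow> 'a set" where
  "quotient_field F D = {a \<otimes>\<^bsub>F\<^esub> inv\<^bsub>F\<^esub> b | a b. a \<in> D \<and> b \<in> D - {\<zero>\<^bsub>F\<^esub>}}"

definition finite_conductor_domain :: "('a, 'b) ring_scheme \<Rightarrow> 'a set \<Rightarrow> bool" where
  "finite_conductor_domain F D \<longleftrightarrow> subdomain D F \<and>
     (\<forall>a \<in> quotient_field F D. \<forall>b \<in> quotient_field F D.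
        finitely_generated (F \<lparr> carrier := D \<rparr>)
          (sub_as_module F ((a <#\<^bsub>F\<^esub> D) \<inter> (b <#\<^bsub>F\<^esub> D))))"

definition valuation_domain :: "('a, 'b) ring_scheme \<Rightarrow> 'a set \<Rightarrow> bool" where
  "valuation_domain F V \<longleftrightarrow> subdomain V F \<and>
     (\<forall>x \<in> quotient_field F V - {\<zero>\<^bsub>F\<^esub>}. x \<in> V \<or> inv\<^bsub>F\<^esub> x \<in> V)"

section \<open>Local quadratic transforms and quadratic Shannon extensions\<close>

definition local_domain :: "('a, 'b) ring_scheme \<Rightarrow> 'a set \<Rightarrow> bool" where
  "local_domain F A \<longleftrightarrow> subdomain A F \<and> local_ring (F \<lparr> carrier := A \<rparr>)"

abbreviation max_ideal_of :: "('a, 'b) ring_scheme \<Rightarrow> 'a set \<Rightarrow> 'a set" where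
  "max_ideal_of F A \<equiv> max_ideal (F \<lparr> carrier := A \<rparr>)"

definition birationally_dominates :: "('a, 'b) ring_scheme \<Rightarrow> 'a set \<Rightarrow> 'a set \<Rightarrow> bool" where
  "birationally_dominates F B A \<longleftrightarrow> local_domain F A \<and> local_domain F B \<and>
     A \<subseteq> B \<and> B \<subseteq> quotient_field F A \<and> max_ideal_of F A \<subseteq> max_ideal_of F B"

definition localization_at :: "('a, 'b) ring_scheme \<Rightarrow> 'a set \<Rightarrow> 'a set \<Rightarrow> 'a set" where
  "localization_at F A P = {a \<otimes>\<^bsub>F\<^esub> inv\<^bsub>F\<^esub> s | a s. a \<in> A \<and> s \<in> A - P}"

definition blowup_chart :: "('a, 'b) ring_scheme \<Rightarrow> 'a set \<Rightarrow> 'a \<Rightarrow> 'a set" where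
  "blowup_chart F R x =
     generate_ring F (R \<union> {y \<otimes>\<^bsub>F\<^esub> inv\<^bsub>F\<^esub> x | y. y \<in> max_ideal_of F R})"

text \<open>The requirement \<open>x \<noteq> 0\<close> follows from \<open>\<mm>V = xV\<close> unless \<open>R\<close> is a field, in which case
  \<open>\<mm>/x\<close> would be meaningless.\<close>

definition is_lqt_along :: "('a, 'b) ring_scheme \<Rightarrow> 'a set \<Rightarrow> 'a set \<Rightarrow> 'a set \<Rightarrow> bool" where
  "is_lqt_along F R V R1 \<longleftrightarrow>
     local_domain F R \<and> noetherian_ring (F \<lparr> carrier := R \<rparr>) \<and>
     valuation_domain F V \<and> birationally_dominates F V R \<and>
     (\<exists>x \<in> max_ideal_of F R. x \<noteq> \<zero>\<^bsub>F\<^esub> \<and>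
        Idl\<^bsub>F \<lparr> carrier := V \<rparr>\<^esub> (max_ideal_of F R) = PIdl\<^bsub>F \<lparr> carrier := V \<rparr>\<^esub> x \<and>
        R1 = localization_at F (blowup_chart F R x) (max_ideal_of F V \<inter> blowup_chart F R x))"

definition is_lqt :: "('a, 'b) ring_scheme \<Rightarrow> 'a set \<Rightarrow> 'a set \<Rightarrow> bool" where
  "is_lqt F R R1 \<longleftrightarrow> (\<exists>V. is_lqt_along F R V R1)"

definition quadratic_shannon_extension :: "('a, 'b) ring_scheme \<Rightarrow> 'a set \<Rightarrow> 'a set \<Rightarrow> bool" where
  "quadratic_shannon_extension F R S \<longleftrightarrow>
     (\<exists>Rs :: nat \<Rightarrow> 'a set. Rs 0 = R \<and>
        (\<forall>n. subdomain (Rs n) F \<and>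
             regular_local_ring (F \<lparr> carrier := Rs n \<rparr>) \<and>
             2 \<le> krull_dim (F \<lparr> carrier := Rs n \<rparr>) \<and>
             is_lqt F (Rs n) (Rs (Suc n))) \<and>
        S = (\<Union>n. Rs n))"

end

theory Submission
  imports Defs
begin

text \<open>
  Let \<open>S = \<Union>R\<^sub>n\<close>. The transform \<open>R\<^sub>n \<rightarrow> R\<^sub>n\<^sub>+\<^sub>1\<close> divides the maximal ideal of \<open>R\<^sub>n\<close> by an
  element \<open>x\<^sub>n\<close> of it that stays a nonunit in \<open>R\<^sub>n\<^sub>+\<^sub>1\<close>, and hence in \<open>S\<close>. So any two nonunits
  \<open>a, b\<close> of \<open>S\<close>, being nonunits of a common \<open>R\<^sub>n\<close>, have the common nonunit divisor \<open>x\<^sub>n\<close> in \<open>S\<close>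
  (\<open>shannon_nonunits_share_divisor\<close>): the maximal ideal of \<open>S\<close> is a directed union of
  principal ideals. For every domain \<open>D\<close> with this divisor property, each of the four conditions is
  equivalent to divisibility being a total relation on \<open>D\<close>.

  The crux is that \<open>D\<close> has total divisibility as soon as all \<open>N = aD \<inter> bD\<close> are finitely
  generated (\<open>divides_total_if_fg_intersections\<close>). Suppose that neither of \<open>a, b\<close> divides the
  other. A generator \<open>g = ta = sb\<close> of \<open>N\<close> then has nonunit cofactors \<open>t, s\<close>. Finitely many
  nonunits have a common nonunit divisor \<open>x\<close>; apply this to the cofactors of all generators. Then
  \<open>g/x = (t/x)a = (s/x)b\<close> again lies in \<open>N\<close>, whence \<open>N = xN\<close>. Nakayama's lemma yields \<open>N = 0\<close>,
  which contradicts \<open>0 \<noteq> ab \<in> N\<close>.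

  The intersections \<open>aD \<inter> bD\<close> are finitely generated in a GCD domain and in a finite conductor
  domain by definition. In a coherent ring one reads generators off a finite presentation of the
  ideal \<open>aD + bD\<close> (\<open>fg_intersections_if_coherent\<close>). Conversely, when divisibility is total,
  finitely generated ideals are principal and principal (fractional) ideals are nested, which makes
  the four conditions immediate.
\<close>

section \<open>Nakayama's lemma\<close>

lemma (in cring) genideal_insert:
  assumes "a \<in> carrier R" and "A \<subseteq> carrier R"
  shows "Idl (insert a A) = PIdl a <+>\<^bsub>R\<^esub> Idl A"
proof -
  note I = cgenideal_ideal[OF assms(1)] and J = genideal_ideal[OF assms(2)]
  have "Idl (PIdl a \<union> Idl A) = Idl (insert a A)"
  proof
    have sub: "insert a A \<subseteq> carrier R" using assms by auto
    have "PIdl a \<subseteq> Idl (insert a A)"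
      using cgenideal_minimal[OF genideal_ideal[OF sub]] genideal_self[OF sub] by auto
    moreover have "Idl A \<subseteq> Idl (insert a A)"
      using subset_Idl_subset[OF sub] by blast
    ultimately show "Idl (PIdl a \<union> Idl A) \<subseteq> Idl (insert a A)"
      using genideal_minimal[OF genideal_ideal[OF sub]] by simp
    have sub': "PIdl a \<union> Idl A \<subseteq> carrier R"
      using ideal.Icarr[OF I] ideal.Icarr[OF J] by auto
    have "insert a A \<subseteq> PIdl a \<union> Idl A"
      using cgenideal_self[OF assms(1)] genideal_self[OF assms(2)] by auto
    then show "Idl (insert a A) \<subseteq> Idl (PIdl a \<union> Idl A)"
      using subset_Idl_subset[OF sub'] by blast
  qed
  then show ?thesis using union_genideal[OF I J] by simp
qed

text \<open>Generators are discarded one at a time: if \<open>a = x (r a + i)\<close> with \<open>i\<close> in the ideal of the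
  other generators, then \<open>(1 - x r) a = x i\<close> and \<open>1 - x r\<close> is a unit, so \<open>a\<close> is redundant.\<close>

lemma (in cring) nakayama_principal:
  assumes x: "x \<in> carrier R"
    and jac: "\<And>r. r \<in> carrier R \<Longrightarrow> \<one> \<ominus> x \<otimes> r \<in> Units R"
    and "finite A" and "A \<subseteq> carrier R"
    and "\<And>g. g \<in> A \<Longrightarrow> \<exists>h \<in> Idl A. g = x \<otimes> h"
  shows "A \<subseteq> {\<zero>}"
  using assms(3-)
proof (induction A rule: finite_induct)
  case empty
  then show ?case by simp
next
  case (insert a A)
  have a: "a \<in> carrier R" and A: "A \<subseteq> carrier R" using insert.prems by auto
  note J = genideal_ideal[OF A]
  obtain h where h: "h \<in> Idl (insert a A)" "a = x \<otimes> h" using insert.prems(2)[of a] by auto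
  then obtain r i where r: "r \<in> carrier R" and i: "i \<in> Idl A" and hri: "h = r \<otimes> a \<oplus> i"
    unfolding genideal_insert[OF a A] set_add_def' cgenideal_def by blast
  have ic: "i \<in> carrier R" using ideal.Icarr[OF J i] .
  define u where "u = \<one> \<ominus> x \<otimes> r"
  have u: "u \<in> Units R" unfolding u_def using jac r by simp
  have "u \<otimes> a = a \<ominus> x \<otimes> r \<otimes> a" unfolding u_def using x r a by algebra
  also have "\<dots> = x \<otimes> (r \<otimes> a \<oplus> i) \<ominus> x \<otimes> r \<otimes> a"
    using h(2) hri by (metis (no_types))
  also have "\<dots> = x \<otimes> i" using x r a ic by algebra
  finally have "u \<otimes> a \<in> Idl A" using ideal.I_l_closed[OF J i x] by simp
  then have "inv u \<otimes> (u \<otimes> a) \<in> Idl A" using ideal.I_l_closed[OF J] u by simp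
  moreover have "inv u \<otimes> (u \<otimes> a) = a" using u a m_assoc[of "inv u" u a] by (simp add: Units_closed)
  ultimately have aA: "a \<in> Idl A" by simp
  then have eq: "Idl (insert a A) = Idl A"
    using genideal_minimal[OF J] genideal_self[OF A] subset_Idl_subset[of "insert a A" A] a A by blast
  have A0: "A \<subseteq> {\<zero>}"
  proof (rule insert.IH[OF A])
    fix g assume "g \<in> A"
    then show "\<exists>h \<in> Idl A. g = x \<otimes> h" using insert.prems(2)[of g] eq by auto
  qed
  then have "a \<in> {\<zero>}" using genideal_minimal[OF zeroideal A0] aA by auto
  then show ?case using A0 by simp
qed

section \<open>Domains whose nonunits share nonunit divisors\<close>

definition nonunits_share_divisor :: "('a, 'b) ring_scheme \<Rightarrow> bool" where
  "nonunits_share_divisor D \<longleftrightarrow>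
     (\<forall>a \<in> carrier D - Units D. \<forall>b \<in> carrier D - Units D.
        \<exists>x \<in> carrier D - Units D. x divides\<^bsub>D\<^esub> a \<and> x divides\<^bsub>D\<^esub> b)"

definition divides_total :: "('a, 'b) ring_scheme \<Rightarrow> bool" where
  "divides_total D \<longleftrightarrow>
     (\<forall>a \<in> carrier D. \<forall>b \<in> carrier D. a divides\<^bsub>D\<^esub> b \<or> b divides\<^bsub>D\<^esub> a)"

definition fg_intersections :: "('a, 'b) ring_scheme \<Rightarrow> bool" where
  "fg_intersections D \<longleftrightarrow>
     (\<forall>a \<in> carrier D. \<forall>b \<in> carrier D. \<exists>A \<subseteq> carrier D. finite A \<and>
        PIdl\<^bsub>D\<^esub> a \<inter> PIdl\<^bsub>D\<^esub> b = Idl\<^bsub>D\<^esub> A)"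

text \<open>By induction on the set: the divisor found for the smaller set is itself a nonunit, so it
  shares a nonunit divisor with the new element. The divisor of the empty set is \<open>0\<close>.\<close>

lemma (in domain) finite_nonunits_share_divisor:
  assumes "nonunits_share_divisor R" and "finite A" and "A \<subseteq> carrier R - Units R"
  shows "\<exists>x \<in> carrier R - Units R. \<forall>a\<in>A. x divides a"
  using assms(2,3)
proof (induction A rule: finite_induct)
  case empty
  have "\<zero> \<notin> Units R"
    by (metis Units_inv_closed Units_l_inv one_not_zero r_null)
  then show ?case by blast
next
  case (insert a A)
  then obtain x where x: "x \<in> carrier R - Units R" "\<forall>a\<in>A. x divides a" by auto
  obtain y where y: "y \<in> carrier R - Units R" "y divides a" "y divides x"
    using assms(1) x(1) insert.prems unfolding nonunits_share_divisor_def by blast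
  have "\<forall>b\<in>insert a A. y divides b"
    using x(2) y divides_trans[OF y(3)] by blast
  then show ?case using y(1) by blast
qed

text \<open>Nonunits lie in the Jacobson radical: a nonunit \<open>1 - x r\<close> would share a nonunit divisor with
  \<open>x\<close>, which would then divide \<open>1\<close>.\<close>

lemma (in domain) one_minus_nonunit_mult:
  assumes "nonunits_share_divisor R" and x: "x \<in> carrier R - Units R" and r: "r \<in> carrier R"
  shows "\<one> \<ominus> x \<otimes> r \<in> Units R"
proof (rule ccontr)
  assume n: "\<one> \<ominus> x \<otimes> r \<notin> Units R"
  obtain y where y: "y \<in> carrier R - Units R" "y divides (\<one> \<ominus> x \<otimes> r)" "y divides x"
    using assms n unfolding nonunits_share_divisor_def
    by (metis DiffD1 DiffI m_closed minus_closed one_closed)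
  obtain s t where st: "s \<in> carrier R" "t \<in> carrier R" "\<one> \<ominus> x \<otimes> r = y \<otimes> s" "x = y \<otimes> t"
    using y(2,3) by (auto elim!: dividesE)
  have "x \<in> carrier R" using x by simp
  then have "\<one> = (\<one> \<ominus> x \<otimes> r) \<oplus> x \<otimes> r" using r by algebra
  also have "\<dots> = y \<otimes> (s \<oplus> t \<otimes> r)" unfolding st(3) using st(1,2,4) y(1) r
    by (simp add: r_distr m_assoc)
  finally have "\<one> = y \<otimes> (s \<oplus> t \<otimes> r)" .
  then have "y divides \<one>" using dividesI[of "s \<oplus> t \<otimes> r" R \<one> y] st(1,2) r by simp
  then show False using y(1) divides_one by auto
qed

text \<open>If neither \<open>a\<close> nor \<open>b\<close> divides the other, then the cofactors of the generators of
  \<open>N = aR \<inter> bR\<close> are nonunits, and dividing all of them by a common nonunit \<open>x\<close> shows \<open>N = xN\<close>.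
  Nakayama's lemma makes \<open>N\<close> zero although it contains \<open>ab\<close>.\<close>

lemma (in domain) divides_total_if_fg_intersections:
  assumes share: "nonunits_share_divisor R" and fg: "fg_intersections R"
  shows "divides_total R"
  unfolding divides_total_def
proof (intro ballI, rule ccontr)
  fix a b assume a: "a \<in> carrier R" and b: "b \<in> carrier R"
    and "\<not> (a divides b \<or> b divides a)"
  then have nab: "\<not> a divides b" and nba: "\<not> b divides a" by auto
  have ab0: "a \<noteq> \<zero>" "b \<noteq> \<zero>" using nab nba divides_zero a b by auto
  define N where "N = PIdl a \<inter> PIdl b"
  obtain A where A: "A \<subseteq> carrier R" "finite A" "N = Idl A"
    using fg a b unfolding fg_intersections_def N_def by blast
  have "\<exists>t s. t \<in> carrier R - Units R \<and> s \<in> carrier R - Units R \<and> g = t \<otimes> a \<and> g = s \<otimes> b"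
    if g: "g \<in> A" for g
  proof -
    have "g \<in> N" using A genideal_self[OF A(1)] g by auto
    then obtain t s where ts: "t \<in> carrier R" "s \<in> carrier R" "g = t \<otimes> a" "g = s \<otimes> b"
      unfolding N_def cgenideal_def by auto
    have "t \<notin> Units R"
    proof
      assume t: "t \<in> Units R"
      then have "inv t \<otimes> (s \<otimes> b) = inv t \<otimes> (t \<otimes> a)" using ts by simp
      then have "a = b \<otimes> (inv t \<otimes> s)" using t ts a b
        by (metis Units_inv_closed Units_l_inv l_one m_assoc m_closed m_comm)
      then show False using nba t ts by (auto intro: dividesI)
    qed
    moreover have "s \<notin> Units R"
    proof
      assume s: "s \<in> Units R"
      then have "inv s \<otimes> (t \<otimes> a) = inv s \<otimes> (s \<otimes> b)" using ts by simp
      then have "b = a \<otimes> (inv s \<otimes> t)" using s ts a b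
        by (metis Units_inv_closed Units_l_inv l_one m_assoc m_closed m_comm)
      then show False using nab s ts by (auto intro: dividesI)
    qed
    ultimately show ?thesis using ts by blast
  qed
  then obtain t s where ts: "\<And>g. g \<in> A \<Longrightarrow> t g \<in> carrier R - Units R"
      "\<And>g. g \<in> A \<Longrightarrow> s g \<in> carrier R - Units R"
      "\<And>g. g \<in> A \<Longrightarrow> g = t g \<otimes> a" "\<And>g. g \<in> A \<Longrightarrow> g = s g \<otimes> b"
    by metis
  obtain x where x: "x \<in> carrier R - Units R" "\<forall>c \<in> t ` A \<union> s ` A. x divides c"
    using finite_nonunits_share_divisor[OF share, of "t ` A \<union> s ` A"] A(2) ts(1,2) by auto
  have "\<exists>h \<in> Idl A. g = x \<otimes> h" if g: "g \<in> A" for g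
  proof (cases "x = \<zero>")
    (* Then the cofactors divisible by x vanish, so g = 0, and there is nothing to divide. *)
    case True
    have "x divides t g" using x(2) g by simp
    then have "g = \<zero>" using True ts(3)[OF g] a zero_divides by simp
    moreover have "\<zero> \<in> Idl A"
      using genideal_ideal[OF A(1)] by (simp add: additive_subgroup.zero_closed ideal_def)
    moreover have "\<zero> = x \<otimes> \<zero>" using True by simp
    ultimately show ?thesis by blast
  next
    case False
    obtain t' s' where t': "t' \<in> carrier R" "t g = x \<otimes> t'" and s': "s' \<in> carrier R" "s g = x \<otimes> s'"
      using x(2) g by (meson UnI1 UnI2 dividesE imageI)
    have "x \<otimes> (t' \<otimes> a) = x \<otimes> (s' \<otimes> b)"
      using ts(3,4)[OF g] t' s' a b x(1) by (metis DiffD1 m_assoc)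
    then have "t' \<otimes> a = s' \<otimes> b" using False x(1) t' s' a b by (simp add: m_lcancel)
    then have "t' \<otimes> a \<in> N" unfolding N_def cgenideal_def using t' s' by blast
    moreover have "g = x \<otimes> (t' \<otimes> a)" using ts(3)[OF g] t' a x(1) by (simp add: m_assoc)
    ultimately show ?thesis using A(3) by auto
  qed
  then have "A \<subseteq> {\<zero>}"
    using nakayama_principal[of x A] one_minus_nonunit_mult[OF share x(1)] x(1) A by blast
  then have "N \<subseteq> {\<zero>}" using genideal_minimal[OF zeroideal] A(3) by simp
  moreover have "a \<otimes> b \<in> N" unfolding N_def cgenideal_def using a b m_comm by auto
  ultimately show False using ab0 a b integral by blast
qed

lemma (in cring) PIdl_subset_iff_divides:
  assumes "a \<in> carrier R" "b \<in> carrier R"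
  shows "PIdl b \<subseteq> PIdl a \<longleftrightarrow> a divides b"
  using to_contain_is_to_divide[OF assms] by simp

lemma (in domain) gcd_domain_iff_divides_total:
  assumes "nonunits_share_divisor R"
  shows "gcd_domain R \<longleftrightarrow> divides_total R"
proof
  assume gcd: "gcd_domain R"
  have "fg_intersections R" unfolding fg_intersections_def
  proof (intro ballI)
    fix a b assume "a \<in> carrier R" "b \<in> carrier R"
    then interpret principalideal "PIdl a \<inter> PIdl b" R using gcd unfolding gcd_domain_def by blast
    obtain i where "i \<in> carrier R" "PIdl a \<inter> PIdl b = Idl {i}" using generate by blast
    then show "\<exists>A\<subseteq>carrier R. finite A \<and> PIdl a \<inter> PIdl b = Idl A" by (intro exI[of _ "{i}"]) simp
  qed
  then show "divides_total R" using divides_total_if_fg_intersections assms by blast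
next
  assume tot: "divides_total R"
  show "gcd_domain R" unfolding gcd_domain_def
  proof (intro conjI ballI)
    show "domain R" by (rule domain_axioms)
    fix a b assume ab: "a \<in> carrier R" "b \<in> carrier R"
    then consider "PIdl b \<subseteq> PIdl a" | "PIdl a \<subseteq> PIdl b"
      using tot unfolding divides_total_def by (auto simp: PIdl_subset_iff_divides)
    then show "principalideal (PIdl a \<inter> PIdl b) R"
      by cases (auto simp: Int_absorb1 Int_absorb2 cgenideal_is_principalideal ab)
  qed
qed


section \<open>Ideals as modules\<close>

lemma (in module) submoduleI_smult:
  assumes "H \<subseteq> carrier M" "\<zero>\<^bsub>M\<^esub> \<in> H"
    and "\<And>a b. \<lbrakk>a \<in> H; b \<in> H\<rbrakk> \<Longrightarrow> a \<oplus>\<^bsub>M\<^esub> b \<in> H"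
    and "\<And>a x. \<lbrakk>a \<in> carrier R; x \<in> H\<rbrakk> \<Longrightarrow> a \<odot>\<^bsub>M\<^esub> x \<in> H"
  shows "submodule H R M"
proof (rule submoduleI)
  fix a assume a: "a \<in> H"
  then have "\<ominus>\<^bsub>M\<^esub> a = (\<ominus> \<one>) \<odot>\<^bsub>M\<^esub> a" using assms(1) smult_l_minus[of \<one> a] by auto
  then show "\<ominus>\<^bsub>M\<^esub> a \<in> H" using assms(4)[of "\<ominus> \<one>" a] a by simp
qed (use assms in auto)

text \<open>Stated for subsets of a ring \<open>F\<close> that are closed under multiplication by a subring, so that it
  covers both ideals and fractional ideals.\<close>

lemma module_sub_as_module:
  assumes "cring F" and "subring S F" and "B \<subseteq> carrier F" and "\<zero>\<^bsub>F\<^esub> \<in> B"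
    and add: "\<And>x y. x \<in> B \<Longrightarrow> y \<in> B \<Longrightarrow> x \<oplus>\<^bsub>F\<^esub> y \<in> B"
    and smult: "\<And>s x. s \<in> S \<Longrightarrow> x \<in> B \<Longrightarrow> s \<otimes>\<^bsub>F\<^esub> x \<in> B"
  shows "module (F \<lparr> carrier := S \<rparr>) (sub_as_module F B)"
proof -
  interpret cring F by fact
  note S = subringE[OF assms(2)]
  have BF: "\<And>x. x \<in> B \<Longrightarrow> x \<in> carrier F" using assms(3) by auto
  have SF: "\<And>x. x \<in> S \<Longrightarrow> x \<in> carrier F" using S(1) by auto
  show ?thesis
  proof (rule moduleI)
    show "cring (F\<lparr>carrier := S\<rparr>)"
      using subcring_iff[OF S(1)] subcringI'[OF assms(2)] by simp
    show "abelian_group (sub_as_module F B)"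
    proof (rule abelian_groupI)
      fix x assume "x \<in> carrier (sub_as_module F B)"
      then have x: "x \<in> B" by (simp add: sub_as_module_def)
      have "\<ominus>\<^bsub>F\<^esub> \<one>\<^bsub>F\<^esub> \<otimes>\<^bsub>F\<^esub> x \<in> B" using smult[OF S(5)[OF S(3)] x] .
      moreover have "(\<ominus>\<^bsub>F\<^esub> \<one>\<^bsub>F\<^esub> \<otimes>\<^bsub>F\<^esub> x) \<oplus>\<^bsub>F\<^esub> x = \<zero>\<^bsub>F\<^esub>" using BF[OF x] by algebra
      ultimately show "\<exists>y\<in>carrier (sub_as_module F B). y \<oplus>\<^bsub>sub_as_module F B\<^esub> x = \<zero>\<^bsub>sub_as_module F B\<^esub>"
        by (auto simp: sub_as_module_def)
    qed (use assms BF in \<open>auto simp: sub_as_module_def a_assoc a_comm a_lcomm\<close>)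
  qed (use assms BF SF in \<open>auto simp: sub_as_module_def l_distr r_distr m_assoc\<close>)
qed

lemma (in cring) module_ideal:
  assumes "ideal I R"
  shows "module R (sub_as_module R I)"
proof -
  interpret ideal I R by fact
  have "module (R \<lparr> carrier := carrier R \<rparr>) (sub_as_module R I)"
    by (rule module_sub_as_module[OF is_cring carrier_is_subring])
      (auto simp: I_l_closed Icarr)
  then show ?thesis by simp
qed

lemma (in cring) submodule_of_ideal_iff:
  assumes "ideal I R"
  shows "submodule N R (sub_as_module R I) \<longleftrightarrow> ideal N R \<and> N \<subseteq> I"
proof -
  interpret I: ideal I R by fact
  interpret M: module R "sub_as_module R I" by (rule module_ideal[OF assms])
  show ?thesis
  proof
    assume N: "submodule N R (sub_as_module R I)"
    note E = M.submoduleE[OF N]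
    have NI: "N \<subseteq> I" using E(1) by (simp add: sub_as_module_def)
    have sm: "r \<otimes> x \<in> N" if "r \<in> carrier R" "x \<in> N" for r x
      using E(4)[OF that] by (simp add: sub_as_module_def)
    have "subgroup N (add_monoid R)"
    proof (rule add.subgroupI)
      show "N \<subseteq> carrier R" "N \<noteq> {}" using NI I.Icarr E(2) by auto
      fix x assume x: "x \<in> N"
      have "\<ominus> x = (\<ominus> \<one>) \<otimes> x" using x NI I.Icarr by (simp add: l_minus subset_iff)
      then show "\<ominus> x \<in> N" using sm[of "\<ominus> \<one>" x] x by simp
      fix y assume "y \<in> N"
      then show "x \<oplus> y \<in> N" using E(5)[OF x] by (simp add: sub_as_module_def)
    qed
    moreover have "x \<otimes> r \<in> N" if "r \<in> carrier R" "x \<in> N" for r x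
      using sm[OF that] m_comm[of x r] that NI I.Icarr by auto
    ultimately show "ideal N R \<and> N \<subseteq> I"
      using NI sm by (intro conjI idealI[OF ring_axioms]) auto
  next
    assume "ideal N R \<and> N \<subseteq> I"
    then interpret N: ideal N R by simp
    show "submodule N R (sub_as_module R I)"
      using \<open>ideal N R \<and> N \<subseteq> I\<close>
      by (intro M.submoduleI_smult) (auto simp: sub_as_module_def N.I_l_closed)
  qed
qed

text \<open>The submodules of an ideal are the ideals contained in it, so generation as a module and
  generation as an ideal agree.\<close>

lemma (in cring) finitely_generated_ideal_iff:
  assumes "ideal I R"
  shows "finitely_generated R (sub_as_module R I) \<longleftrightarrow>
    (\<exists>A \<subseteq> carrier R. finite A \<and> I = Idl A)"
proof -
  have *: "\<Inter>{N. submodule N R (sub_as_module R I) \<and> A \<subseteq> N} = Idl A" if A: "A \<subseteq> I" for A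
  proof -
    have "Idl A \<subseteq> I" using genideal_minimal[OF assms A] .
    moreover have "ideal (Idl A) R" "A \<subseteq> Idl A"
      using A ideal.Icarr[OF assms] by (auto intro!: genideal_ideal genideal_self[THEN subsetD])
    ultimately show ?thesis
      unfolding submodule_of_ideal_iff[OF assms] using genideal_minimal by blast
  qed
  have c: "carrier (sub_as_module R I) = I" by (simp add: sub_as_module_def)
  have IR: "I \<subseteq> carrier R" using ideal.Icarr[OF assms] by auto
  show ?thesis
  proof
    assume "finitely_generated R (sub_as_module R I)"
    then obtain A where A: "A \<subseteq> I" "finite A"
        "\<Inter>{N. submodule N R (sub_as_module R I) \<and> A \<subseteq> N} = I"
      unfolding finitely_generated_def c by blast
    show "\<exists>A \<subseteq> carrier R. finite A \<and> I = Idl A"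
      using A(1,2) A(3)[unfolded *[OF A(1)]] IR by (intro exI[of _ A]) auto
  next
    assume "\<exists>A \<subseteq> carrier R. finite A \<and> I = Idl A"
    then obtain A where A: "A \<subseteq> carrier R" "finite A" "I = Idl A" by blast
    have AI: "A \<subseteq> I" using genideal_self[OF A(1)] A(3) by simp
    show "finitely_generated R (sub_as_module R I)"
      unfolding finitely_generated_def c
      using module_ideal[OF assms] AI A(2) *[OF AI] A(3) by (intro conjI exI[of _ A]) simp_all
  qed
qed

section \<open>Coherence\<close>

definition unit_vector :: "('a, 'b) ring_scheme \<Rightarrow> nat \<Rightarrow> nat \<Rightarrow> nat \<Rightarrow> 'a" where
  "unit_vector R n i = (\<lambda>j\<in>{..<n}. if j = i then \<one>\<^bsub>R\<^esub> else \<zero>\<^bsub>R\<^esub>)"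

text \<open>Every vector is a linear combination of the unit vectors; the proof clears the coordinates of
  \<open>v\<close> from the last one downwards.\<close>

lemma (in cring) free_module_induct:
  fixes n
  defines "M \<equiv> free_module R n"
  assumes zero: "P \<zero>\<^bsub>M\<^esub>"
    and add: "\<And>v w. v \<in> carrier M \<Longrightarrow> w \<in> carrier M \<Longrightarrow> P v \<Longrightarrow> P w \<Longrightarrow> P (v \<oplus>\<^bsub>M\<^esub> w)"
    and unit: "\<And>r i. r \<in> carrier R \<Longrightarrow> i < n \<Longrightarrow> P (r \<odot>\<^bsub>M\<^esub> unit_vector R n i)"
    and v: "v \<in> carrier M"
  shows "P v"
proof -
  have carr: "carrier M = {..<n} \<rightarrow>\<^sub>E carrier R" by (simp add: M_def free_module_def)
  have M_simps: "\<zero>\<^bsub>M\<^esub> = (\<lambda>i\<in>{..<n}. \<zero>)"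
    "\<And>v w. v \<oplus>\<^bsub>M\<^esub> w = (\<lambda>i\<in>{..<n}. v i \<oplus> w i)"
    "\<And>r v. r \<odot>\<^bsub>M\<^esub> v = (\<lambda>i\<in>{..<n}. r \<otimes> v i)"
    by (simp_all add: M_def free_module_def)
  have "P v" if "v \<in> carrier M" "k \<le> n" "\<And>i. k \<le> i \<Longrightarrow> i < n \<Longrightarrow> v i = \<zero>" for k v
    using that
  proof (induction k arbitrary: v)
    case 0
    have "v = \<zero>\<^bsub>M\<^esub>"
    proof
      fix j show "v j = \<zero>\<^bsub>M\<^esub> j"
        using 0(3)[of j] PiE_arb[OF 0(1)[unfolded carr], of j] by (cases "j < n") (auto simp: M_simps)
    qed
    then show ?case using zero by simp
  next
    case (Suc k)
    note v = Suc.prems(1)[unfolded carr]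
    have k: "k < n" using Suc.prems(2) by simp
    then have vk: "v k \<in> carrier R" using PiE_mem[OF v, of k] by simp
    define w where "w = v(k := \<zero>)"
    have w: "w \<in> carrier M"
      unfolding carr w_def using PiE_mem[OF v] PiE_arb[OF v] k by (intro PiE_I) auto
    have "P w"
    proof (rule Suc.IH[OF w])
      fix i assume "k \<le> i" "i < n"
      then show "w i = \<zero>" using Suc.prems(3)[of i] by (cases "i = k") (auto simp: w_def)
    qed (use k in simp)
    moreover have "P (v k \<odot>\<^bsub>M\<^esub> unit_vector R n k)" using unit vk k by simp
    moreover have "v k \<odot>\<^bsub>M\<^esub> unit_vector R n k \<in> carrier M"
      unfolding carr M_simps using vk by (auto simp: unit_vector_def)
    moreover have "v = w \<oplus>\<^bsub>M\<^esub> (v k \<odot>\<^bsub>M\<^esub> unit_vector R n k)"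
    proof
      fix j
      show "v j = (w \<oplus>\<^bsub>M\<^esub> (v k \<odot>\<^bsub>M\<^esub> unit_vector R n k)) j"
        using vk k PiE_mem[OF v, of j] PiE_arb[OF v, of j]
        by (cases "j < n"; cases "j = k") (simp_all add: M_simps unit_vector_def w_def)
    qed
    ultimately show ?case using add[OF w] by metis
  qed
  from this[OF v, of n] show ?thesis by simp
qed

text \<open>
  Let \<open>f : R\<^sup>n \<rightarrow> aR + bR\<close> be onto with finitely generated kernel \<open>K\<close>. Writing the images of the
  unit vectors as \<open>r\<^sub>i a + s\<^sub>i b\<close> splits \<open>f\<close> as \<open>f(v) = \<rho>(v) a + \<sigma>(v) b\<close> with \<open>\<rho>, \<sigma>\<close> linear. For
  \<open>k \<in> K\<close> the element \<open>\<rho>(k) a = -\<sigma>(k) b\<close> lies in \<open>aR \<inter> bR\<close>, and these elements almost exhaust the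
  intersection. Choose \<open>u, v\<close> with \<open>f(u) = a\<close> and \<open>f(v) = b\<close>. If \<open>w = p a = q b\<close>, then
  \<open>z = p u - q v\<close> lies in \<open>K\<close> and
  \<open>w = \<rho>(z) a - p (\<rho>(u) a - a) + q \<rho>(v) a\<close>.
  Both corrections \<open>\<rho>(u) a - a = -\<sigma>(u) b\<close> and \<open>\<rho>(v) a = b - \<sigma>(v) b\<close> lie in the intersection, so
  they and the images of generators of \<open>K\<close> generate it. This is Schanuel's lemma, applied to the
  given presentation and to the surjection of \<open>R\<^sup>2\<close> onto \<open>aR + bR\<close>.
\<close>

lemma (in cring) fg_intersections_if_coherent:
  assumes coh: "coherent_ring R"
  shows "fg_intersections R"
  unfolding fg_intersections_def
proof (intro ballI)
  fix a b assume a: "a \<in> carrier R" and b: "b \<in> carrier R"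
  define I where "I = Idl {a, b}"
  have I: "ideal I R" unfolding I_def using a b by (intro genideal_ideal) auto
  have Isum: "I = PIdl a <+>\<^bsub>R\<^esub> PIdl b"
    unfolding I_def using genideal_insert[of a "{b}"] cgenideal_eq_genideal[of b] a b by simp
  have aI: "a \<in> I" and bI: "b \<in> I" using genideal_self[of "{a,b}"] a b by (auto simp: I_def)
  have "finitely_generated R (sub_as_module R I)"
    unfolding finitely_generated_ideal_iff[OF I] using a b I_def by (intro exI[of _ "{a,b}"]) auto
  then have "finitely_presented R (sub_as_module R I)"
    using coh I unfolding coherent_ring_def by blast
  then obtain n f where f: "f \<in> module_hom R (free_module R n) (sub_as_module R I)"
      and surj: "f ` carrier (free_module R n) = carrier (sub_as_module R I)"
      and ker: "finitely_generated R ((free_module R n) \<lparr> carrier :=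
            a_kernel (free_module R n) (sub_as_module R I) f \<rparr>)"
    unfolding finitely_presented_def by blast
  define M where "M = free_module R n"
  define K where "K = {v \<in> carrier M. f v = \<zero>}"
  have K: "a_kernel (free_module R n) (sub_as_module R I) f = K"
    by (simp add: a_kernel_def kernel_def K_def M_def sub_as_module_def)
  have f_add: "f (v \<oplus>\<^bsub>M\<^esub> w) = f v \<oplus> f w" if "v \<in> carrier M" "w \<in> carrier M" for v w
    using f that by (auto simp: module_hom_def hom_def M_def sub_as_module_def)
  have f_smult: "f (r \<odot>\<^bsub>M\<^esub> v) = r \<otimes> f v" if "r \<in> carrier R" "v \<in> carrier M" for r v
    using f that by (auto simp: module_hom_def hom_def M_def sub_as_module_def)
  have f_img: "f ` carrier M = I" using surj by (simp add: M_def sub_as_module_def)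
  have IR: "\<And>x. x \<in> I \<Longrightarrow> x \<in> carrier R" using ideal.Icarr[OF I] .
  have fI: "f v \<in> I" if "v \<in> carrier M" for v using f_img that by auto
  have fR: "f v \<in> carrier R" if "v \<in> carrier M" for v using fI IR that by auto
  have M_add: "v \<oplus>\<^bsub>M\<^esub> w \<in> carrier M" if "v \<in> carrier M" "w \<in> carrier M" for v w
    using that by (auto simp: M_def free_module_def)
  have M_smult: "r \<odot>\<^bsub>M\<^esub> v \<in> carrier M" if "r \<in> carrier R" "v \<in> carrier M" for r v
    using that by (auto simp: M_def free_module_def)
  have M_zero: "\<zero>\<^bsub>M\<^esub> \<in> carrier M" by (auto simp: M_def free_module_def)
  have f_zero: "f \<zero>\<^bsub>M\<^esub> = \<zero>"
  proof -
    have "\<zero>\<^bsub>M\<^esub> = \<zero> \<odot>\<^bsub>M\<^esub> \<zero>\<^bsub>M\<^esub>" by (auto simp: M_def free_module_def fun_eq_iff)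
    then show ?thesis using f_smult[OF zero_closed M_zero] fR[OF M_zero] by simp
  qed
  have e: "unit_vector R n i \<in> carrier M" for i
    by (auto simp: M_def free_module_def unit_vector_def)
  have "\<exists>r s. r \<in> carrier R \<and> s \<in> carrier R \<and> f (unit_vector R n i) = r \<otimes> a \<oplus> s \<otimes> b" for i
    using fI[OF e[of i]] unfolding Isum set_add_def' cgenideal_def by blast
  then obtain r s where rs: "\<And>i. r i \<in> carrier R" "\<And>i. s i \<in> carrier R"
      "\<And>i. f (unit_vector R n i) = r i \<otimes> a \<oplus> s i \<otimes> b" by metis
  define \<rho> where "\<rho> v = (\<Oplus>i\<in>{..<n}. v i \<otimes> r i)" for v
  have MR: "v i \<in> carrier R" if "v \<in> carrier M" "i < n" for v i
    using that by (auto simp: M_def free_module_def)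
  have \<rho>R: "\<rho> v \<in> carrier R" if "v \<in> carrier M" for v
    unfolding \<rho>_def using MR[OF that] rs(1) by (auto intro!: finsum_closed)
  have \<rho>_add: "\<rho> (v \<oplus>\<^bsub>M\<^esub> w) = \<rho> v \<oplus> \<rho> w" if "v \<in> carrier M" "w \<in> carrier M" for v w
  proof -
    have "\<rho> (v \<oplus>\<^bsub>M\<^esub> w) = (\<Oplus>i\<in>{..<n}. v i \<otimes> r i \<oplus> w i \<otimes> r i)"
      unfolding \<rho>_def using MR[OF that(1)] MR[OF that(2)] rs(1)
      by (intro finsum_cong') (auto simp: M_def free_module_def l_distr)
    also have "\<dots> = \<rho> v \<oplus> \<rho> w"
      unfolding \<rho>_def using MR[OF that(1)] MR[OF that(2)] rs(1) by (intro finsum_addf) auto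
    finally show ?thesis .
  qed
  have \<rho>_smult: "\<rho> (c \<odot>\<^bsub>M\<^esub> v) = c \<otimes> \<rho> v" if "c \<in> carrier R" "v \<in> carrier M" for c v
  proof -
    have "\<rho> (c \<odot>\<^bsub>M\<^esub> v) = (\<Oplus>i\<in>{..<n}. c \<otimes> (v i \<otimes> r i))"
      unfolding \<rho>_def using MR[OF that(2)] rs(1) that(1)
      by (intro finsum_cong') (auto simp: M_def free_module_def m_assoc)
    also have "\<dots> = c \<otimes> \<rho> v"
      unfolding \<rho>_def using MR[OF that(2)] rs(1) that(1) by (intro finsum_rdistr[symmetric]) auto
    finally show ?thesis .
  qed
  have \<rho>_unit: "\<rho> (unit_vector R n i) = r i" if "i < n" for i
  proof -
    have "\<rho> (unit_vector R n i) = (\<Oplus>j\<in>{..<n}. if i = j then r j else \<zero>)"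
      unfolding \<rho>_def using rs(1) by (intro finsum_cong') (auto simp: unit_vector_def)
    also have "\<dots> = r i" using that rs(1) by (intro finsum_singleton) auto
    finally show ?thesis .
  qed
  have \<rho>_zero: "\<rho> \<zero>\<^bsub>M\<^esub> = \<zero>"
  proof -
    have "\<zero>\<^bsub>M\<^esub> = \<zero> \<odot>\<^bsub>M\<^esub> \<zero>\<^bsub>M\<^esub>" by (auto simp: M_def free_module_def fun_eq_iff)
    then show ?thesis using \<rho>_smult[OF zero_closed M_zero] \<rho>R[OF M_zero] by simp
  qed
  have inB: "c \<otimes> b \<in> PIdl b" if "c \<in> carrier R" for c using that by (auto simp: cgenideal_def)
  have inA: "c \<otimes> a \<in> PIdl a" if "c \<in> carrier R" for c using that by (auto simp: cgenideal_def)
  interpret B: ideal "PIdl b" R using cgenideal_ideal[OF b] .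
  (* The splitting of f; the second linear form enters only through its values in bR. *)
  have key: "f v \<ominus> \<rho> v \<otimes> a \<in> PIdl b" if "v \<in> carrier M" for v
  proof (rule free_module_induct[of "\<lambda>v. f v \<ominus> \<rho> v \<otimes> a \<in> PIdl b" n])
    show "f \<zero>\<^bsub>free_module R n\<^esub> \<ominus> \<rho> \<zero>\<^bsub>free_module R n\<^esub> \<otimes> a \<in> PIdl b"
      using f_zero \<rho>_zero a by (simp add: M_def[symmetric] minus_eq)
    show "v \<in> carrier (free_module R n)" using that M_def by simp
  next
    fix v w assume "v \<in> carrier (free_module R n)" "w \<in> carrier (free_module R n)"
      and P: "f v \<ominus> \<rho> v \<otimes> a \<in> PIdl b" "f w \<ominus> \<rho> w \<otimes> a \<in> PIdl b"
    then have vw: "v \<in> carrier M" "w \<in> carrier M" by (auto simp: M_def)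
    have "f (v \<oplus>\<^bsub>M\<^esub> w) \<ominus> \<rho> (v \<oplus>\<^bsub>M\<^esub> w) \<otimes> a = (f v \<ominus> \<rho> v \<otimes> a) \<oplus> (f w \<ominus> \<rho> w \<otimes> a)"
      unfolding f_add[OF vw] \<rho>_add[OF vw]
      using fR[OF vw(1)] fR[OF vw(2)] \<rho>R[OF vw(1)] \<rho>R[OF vw(2)] a by algebra
    then show "f (v \<oplus>\<^bsub>free_module R n\<^esub> w) \<ominus> \<rho> (v \<oplus>\<^bsub>free_module R n\<^esub> w) \<otimes> a \<in> PIdl b"
      using B.a_closed[OF P] by (simp add: M_def)
  next
    fix c i assume c: "c \<in> carrier R" and i: "i < n"
    have "f (c \<odot>\<^bsub>M\<^esub> unit_vector R n i) \<ominus> \<rho> (c \<odot>\<^bsub>M\<^esub> unit_vector R n i) \<otimes> a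
        = c \<otimes> (r i \<otimes> a \<oplus> s i \<otimes> b) \<ominus> c \<otimes> r i \<otimes> a"
      unfolding f_smult[OF c e] \<rho>_smult[OF c e] \<rho>_unit[OF i] rs(3) by simp
    also have "\<dots> = (c \<otimes> s i) \<otimes> b" using c rs(1,2)[of i] a b by algebra
    finally show "f (c \<odot>\<^bsub>free_module R n\<^esub> unit_vector R n i) \<ominus>
        \<rho> (c \<odot>\<^bsub>free_module R n\<^esub> unit_vector R n i) \<otimes> a \<in> PIdl b"
      using inB[of "c \<otimes> s i"] c rs(2)[of i] unfolding M_def by simp
  qed
  obtain u where u: "u \<in> carrier M" "f u = a" using f_img aI by auto
  obtain v where v: "v \<in> carrier M" "f v = b" using f_img bI by auto
  have kmod: "module R (M \<lparr> carrier := K \<rparr>)"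
    using ker unfolding K M_def finitely_generated_def by blast
  obtain G where G: "G \<subseteq> K" "finite G"
      "\<Inter>{N. submodule N R (M \<lparr> carrier := K \<rparr>) \<and> G \<subseteq> N} = K"
    using ker unfolding K M_def finitely_generated_def by auto
  define H where "H = (\<lambda>k. \<rho> k \<otimes> a) ` G \<union> {\<rho> u \<otimes> a \<ominus> a, \<rho> v \<otimes> a}"
  have KM: "\<And>k. k \<in> K \<Longrightarrow> k \<in> carrier M" by (simp add: K_def)
  have HR: "H \<subseteq> carrier R" unfolding H_def using G(1) KM \<rho>R a u(1) v(1) by auto
  have N: "ideal (PIdl a \<inter> PIdl b) R"
    using i_intersect[OF cgenideal_ideal[OF a] cgenideal_ideal[OF b]] .
  have "H \<subseteq> PIdl a \<inter> PIdl b"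
  proof -
    have "\<rho> k \<otimes> a \<in> PIdl b" if k: "k \<in> K" for k
    proof -
      have "\<ominus> (f k \<ominus> \<rho> k \<otimes> a) = \<rho> k \<otimes> a" using k \<rho>R[OF KM[OF k]] a by (simp add: K_def minus_eq)
      then show ?thesis using B.a_inv_closed[OF key[OF KM[OF k]]] by simp
    qed
    moreover have "\<rho> u \<otimes> a \<ominus> a \<in> PIdl b"
    proof -
      have "\<ominus> (f u \<ominus> \<rho> u \<otimes> a) = \<rho> u \<otimes> a \<ominus> a" unfolding u(2) using \<rho>R[OF u(1)] a by algebra
      then show ?thesis using B.a_inv_closed[OF key[OF u(1)]] by simp
    qed
    moreover have "\<rho> v \<otimes> a \<in> PIdl b"
    proof -
      have "\<rho> v \<otimes> a = \<one> \<otimes> b \<oplus> \<ominus> (f v \<ominus> \<rho> v \<otimes> a)" unfolding v(2) using \<rho>R[OF v(1)] a b by algebra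
      then show ?thesis
        using B.a_closed[OF inB[OF one_closed] B.a_inv_closed[OF key[OF v(1)]]] by simp
    qed
    moreover have "\<rho> u \<otimes> a \<ominus> a \<in> PIdl a"
    proof -
      have "\<rho> u \<otimes> a \<ominus> a = (\<rho> u \<ominus> \<one>) \<otimes> a" using \<rho>R[OF u(1)] a by algebra
      then show ?thesis using inA[of "\<rho> u \<ominus> \<one>"] \<rho>R[OF u(1)] by simp
    qed
    ultimately show ?thesis
      unfolding H_def using inA \<rho>R KM v(1) G(1) by auto
  qed
  then have sub: "Idl H \<subseteq> PIdl a \<inter> PIdl b" using genideal_minimal[OF N] by simp
  interpret H: ideal "Idl H" R using genideal_ideal[OF HR] .
  have Hself: "\<And>h. h \<in> H \<Longrightarrow> h \<in> Idl H" using genideal_self[OF HR] by auto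
  (* K is known only as the least submodule containing G, so a property of all its elements is
     proved by showing that the elements that have it form a submodule. *)
  define L where "L = {k \<in> K. \<rho> k \<otimes> a \<in> Idl H}"
  have "submodule L R (M \<lparr> carrier := K \<rparr>)"
  proof (rule module.submoduleI_smult[OF kmod])
    show "L \<subseteq> carrier (M\<lparr>carrier := K\<rparr>)" by (auto simp: L_def)
    show "\<zero>\<^bsub>M\<lparr>carrier := K\<rparr>\<^esub> \<in> L" using M_zero f_zero \<rho>_zero a by (simp add: L_def K_def)
  next
    fix k l assume kl: "k \<in> L" "l \<in> L"
    then have m: "k \<in> carrier M" "l \<in> carrier M" by (auto simp: L_def K_def)
    have "\<rho> (k \<oplus>\<^bsub>M\<^esub> l) \<otimes> a = \<rho> k \<otimes> a \<oplus> \<rho> l \<otimes> a"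
      unfolding \<rho>_add[OF m] using \<rho>R m a by (simp add: l_distr)
    then show "k \<oplus>\<^bsub>M\<lparr>carrier := K\<rparr>\<^esub> l \<in> L"
      using kl f_add[OF m] M_add[OF m] by (simp add: L_def K_def)
  next
    fix c k assume c: "c \<in> carrier R" and k: "k \<in> L"
    then have m: "k \<in> carrier M" by (auto simp: L_def K_def)
    have "\<rho> (c \<odot>\<^bsub>M\<^esub> k) \<otimes> a = c \<otimes> (\<rho> k \<otimes> a)"
      unfolding \<rho>_smult[OF c m] using \<rho>R m a c by (simp add: m_assoc)
    then show "c \<odot>\<^bsub>M\<lparr>carrier := K\<rparr>\<^esub> k \<in> L"
      using k f_smult[OF c m] M_smult[OF c m] H.I_l_closed[of "\<rho> k \<otimes> a" c] c
      by (simp add: L_def K_def)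
  qed
  moreover have "G \<subseteq> L" using G(1) Hself by (auto simp: L_def H_def)
  ultimately have KL: "K \<subseteq> L" using G(3) by blast
  have "PIdl a \<inter> PIdl b \<subseteq> Idl H"
  proof
    fix w assume "w \<in> PIdl a \<inter> PIdl b"
    then obtain p q where p: "p \<in> carrier R" "w = p \<otimes> a" and q: "q \<in> carrier R" "w = q \<otimes> b"
      unfolding cgenideal_def by blast
    define z where "z = p \<odot>\<^bsub>M\<^esub> u \<oplus>\<^bsub>M\<^esub> (\<ominus> q) \<odot>\<^bsub>M\<^esub> v"
    have nq: "\<ominus> q \<in> carrier R" using q by simp
    note pu = M_smult[OF p(1) u(1)] and qv = M_smult[OF nq v(1)]
    have "f z = p \<otimes> a \<oplus> (\<ominus> q) \<otimes> b"
      unfolding z_def f_add[OF pu qv] f_smult[OF p(1) u(1)] f_smult[OF nq v(1)] u(2) v(2) by simp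
    also have "\<dots> = p \<otimes> a \<ominus> q \<otimes> b" using p(1) q(1) a b by algebra
    also have "\<dots> = \<zero>" using p q b by (metis m_closed r_right_minus_eq)
    finally have "z \<in> L" using KL M_add[OF pu qv] by (auto simp: K_def z_def)
    then have z: "\<rho> z \<otimes> a \<in> Idl H" by (simp add: L_def)
    have \<rho>z: "\<rho> z = p \<otimes> \<rho> u \<oplus> (\<ominus> q) \<otimes> \<rho> v"
      unfolding z_def \<rho>_add[OF pu qv] \<rho>_smult[OF p(1) u(1)] \<rho>_smult[OF nq v(1)] by simp
    have "\<rho> z \<otimes> a \<oplus> ((\<ominus> p) \<otimes> (\<rho> u \<otimes> a \<ominus> a) \<oplus> q \<otimes> (\<rho> v \<otimes> a)) \<in> Idl H"
    proof (rule H.a_closed[OF z H.a_closed])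
      have "\<rho> u \<otimes> a \<ominus> a \<in> H" "\<rho> v \<otimes> a \<in> H" by (auto simp: H_def)
      then show "(\<ominus> p) \<otimes> (\<rho> u \<otimes> a \<ominus> a) \<in> Idl H" "q \<otimes> (\<rho> v \<otimes> a) \<in> Idl H"
        using H.I_l_closed[OF Hself] p(1) q(1) by auto
    qed
    moreover have "\<rho> z \<otimes> a \<oplus> ((\<ominus> p) \<otimes> (\<rho> u \<otimes> a \<ominus> a) \<oplus> q \<otimes> (\<rho> v \<otimes> a)) = p \<otimes> a"
      unfolding \<rho>z using p(1) q(1) \<rho>R[OF u(1)] \<rho>R[OF v(1)] a by algebra
    ultimately show "w \<in> Idl H" using p(2) by simp
  qed
  then show "\<exists>A\<subseteq>carrier R. finite A \<and> PIdl a \<inter> PIdl b = Idl A"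
    using sub HR G(2) by (intro exI[of _ H]) (auto simp: H_def)
qed


lemma (in cring) genideal_finite_principal:
  assumes tot: "divides_total R" and A: "finite A" "A \<subseteq> carrier R"
  shows "\<exists>c \<in> carrier R. Idl A = PIdl c"
  using A
proof (induction A rule: finite_induct)
  case empty
  have "Idl {} = Idl {\<zero>}"
    using genideal_minimal[OF zeroideal, of "{}"] genideal_zero
      additive_subgroup.zero_closed[OF ideal.axioms(1)[OF genideal_ideal[of "{}"]]] by auto
  then show ?case using cgenideal_eq_genideal by auto
next
  case (insert a A)
  then obtain c where c: "c \<in> carrier R" "Idl A = PIdl c" by auto
  have a: "a \<in> carrier R" using insert.prems by simp
  have eq: "Idl (insert a A) = PIdl a <+>\<^bsub>R\<^esub> PIdl c"
    using genideal_insert[OF a] insert.prems c by simp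
  have eq': "PIdl a <+>\<^bsub>R\<^esub> PIdl c = Idl {a, c}"
    using genideal_insert[OF a, of "{c}"] c cgenideal_eq_genideal by simp
  have aa: "a \<in> PIdl a" "c \<in> PIdl c" using cgenideal_self a c by auto
  consider "PIdl c \<subseteq> PIdl a" | "PIdl a \<subseteq> PIdl c"
    using tot a c unfolding divides_total_def by (auto simp: PIdl_subset_iff_divides)
  then show ?case
  proof cases
    case 1
    then have "Idl {a, c} \<subseteq> PIdl a"
      using genideal_minimal[OF cgenideal_ideal[OF a], of "{a, c}"] aa by auto
    moreover have "PIdl a \<subseteq> Idl {a, c}"
      using cgenideal_eq_genideal[OF a] subset_Idl_subset[of "{a, c}" "{a}"] a c by auto
    ultimately show ?thesis using eq eq' a by auto
  next
    case 2
    then have "Idl {a, c} \<subseteq> PIdl c"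
      using genideal_minimal[OF cgenideal_ideal[OF c(1)], of "{a, c}"] aa by auto
    moreover have "PIdl c \<subseteq> Idl {a, c}"
      using cgenideal_eq_genideal[OF c(1)] subset_Idl_subset[of "{a, c}" "{c}"] a c by auto
    ultimately show ?thesis using eq eq' c by auto
  qed
qed

text \<open>A principal ideal \<open>cR\<close> is free, of rank \<open>0\<close> or \<open>1\<close> according to whether \<open>c\<close> is zero. With
  this choice of rank the presentation is injective in both cases.\<close>

lemma (in domain) coherent_if_divides_total:
  assumes tot: "divides_total R"
  shows "coherent_ring R"
  unfolding coherent_ring_def
proof (intro conjI allI impI)
  show "cring R" by (rule is_cring)
  fix I assume "ideal I R \<and> finitely_generated R (sub_as_module R I)"
  then have I: "ideal I R" and "finitely_generated R (sub_as_module R I)" by auto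
  then obtain A where A: "A \<subseteq> carrier R" "finite A" "I = Idl A"
    unfolding finitely_generated_ideal_iff[OF I] by blast
  have "\<exists>c \<in> carrier R. Idl A = PIdl c"
    using genideal_finite_principal[OF tot A(2,1)] .
  then obtain c where c: "c \<in> carrier R" "I = PIdl c" using A(3) by auto
  define n :: nat where "n = (if c = \<zero> then 0 else 1)"
  define z where "z = (\<lambda>i\<in>{..<n}. \<zero>)"
  define f where "f v = (if c = \<zero> then \<zero> else v 0 \<otimes> c)" for v :: "nat \<Rightarrow> 'a"
  have sR: "v 0 \<in> carrier R" if "v \<in> {..<n} \<rightarrow>\<^sub>E carrier R" "c \<noteq> \<zero>" for v
    using PiE_mem[OF that(1), of 0] that(2) by (simp add: n_def)
  have f_hom: "f \<in> module_hom R (free_module R n) (sub_as_module R I)"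
  proof -
    have "f v \<in> PIdl c" if "v \<in> {..<n} \<rightarrow>\<^sub>E carrier R" for v
      using sR[OF that] c(1) additive_subgroup.zero_closed[OF ideal.axioms(1)[OF I]]
      by (auto simp: f_def cgenideal_def c(2))
    moreover have "f (\<lambda>i\<in>{..<n}. v i \<oplus> w i) = f v \<oplus> f w"
      if "v \<in> {..<n} \<rightarrow>\<^sub>E carrier R" "w \<in> {..<n} \<rightarrow>\<^sub>E carrier R" for v w
      using sR[OF that(1)] sR[OF that(2)] c(1) by (simp add: f_def n_def l_distr)
    moreover have "f (\<lambda>i\<in>{..<n}. r \<otimes> v i) = r \<otimes> f v"
      if "v \<in> {..<n} \<rightarrow>\<^sub>E carrier R" "r \<in> carrier R" for r v
      using sR[OF that(1)] that(2) c(1) by (simp add: f_def n_def m_assoc)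
    ultimately show ?thesis
      unfolding module_hom_def hom_def free_module_def sub_as_module_def c(2) by simp
  qed
  have f_img: "f ` carrier (free_module R n) = carrier (sub_as_module R I)"
  proof
    show "f ` carrier (free_module R n) \<subseteq> carrier (sub_as_module R I)"
      using f_hom by (auto simp: module_hom_def hom_def)
    show "carrier (sub_as_module R I) \<subseteq> f ` carrier (free_module R n)"
    proof
      fix y assume "y \<in> carrier (sub_as_module R I)"
      then obtain x where x: "x \<in> carrier R" "y = x \<otimes> c"
        unfolding sub_as_module_def c(2) cgenideal_def by auto
      have "y = f (\<lambda>i\<in>{..<n}. x)" using x by (simp add: f_def n_def)
      moreover have "(\<lambda>i\<in>{..<n}. x) \<in> carrier (free_module R n)"
        using x(1) by (simp add: free_module_def)
      ultimately show "y \<in> f ` carrier (free_module R n)" by blast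
    qed
  qed
  have kernel: "a_kernel (free_module R n) (sub_as_module R I) f = {z}"
  proof -
    have "v = z" if v: "v \<in> {..<n} \<rightarrow>\<^sub>E carrier R" and f0: "f v = \<zero>" for v
    proof
      fix i
      show "v i = z i"
      proof (cases "i < n")
        case True
        then have "i = 0" "c \<noteq> \<zero>" by (auto simp: n_def split: if_splits)
        then show ?thesis using f0 sR[OF v] c(1) integral[of "v 0" c] by (auto simp: f_def z_def n_def)
      next
        case False
        then show ?thesis using PiE_arb[OF v, of i] by (simp add: z_def)
      qed
    qed
    moreover have "z \<in> {..<n} \<rightarrow>\<^sub>E carrier R" by (simp add: z_def)
    moreover have "f z = \<zero>" using c(1) by (simp add: f_def z_def n_def)
    ultimately have "{v \<in> {..<n} \<rightarrow>\<^sub>E carrier R. f v = \<zero>} = {z}" by blast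
    then show ?thesis
      by (simp add: a_kernel_def kernel_def free_module_def sub_as_module_def)
  qed
  have z: "(\<lambda>i\<in>{..<n}. z i \<oplus> z i) = z" "(\<lambda>i\<in>{..<n}. \<zero>) = z"
    "\<And>r. r \<in> carrier R \<Longrightarrow> (\<lambda>i\<in>{..<n}. r \<otimes> z i) = z"
    unfolding z_def by (intro ext; simp)+
  have "module R (free_module R n\<lparr>carrier := {z}\<rparr>)"
  proof (rule moduleI[OF is_cring])
    show "abelian_group (free_module R n\<lparr>carrier := {z}\<rparr>)"
      by (rule abelian_groupI) (simp_all add: free_module_def z)
  qed (simp_all add: free_module_def z)
  then have "finitely_generated R (free_module R n\<lparr>carrier := {z}\<rparr>)"
    unfolding finitely_generated_def
  proof (intro conjI exI[of _ "{z}"])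
    assume "module R (free_module R n\<lparr>carrier := {z}\<rparr>)"
    then interpret Z: module R "free_module R n\<lparr>carrier := {z}\<rparr>" .
    show "\<Inter>{N. submodule N R (free_module R n\<lparr>carrier := {z}\<rparr>) \<and> {z} \<subseteq> N} =
        carrier (free_module R n\<lparr>carrier := {z}\<rparr>)"
      using Z.carrier_is_submodule by auto
  qed auto
  then show "finitely_presented R (sub_as_module R I)"
    unfolding finitely_presented_def using module_ideal[OF I] f_hom f_img kernel by metis
qed

lemma (in domain) coherent_iff_divides_total:
  assumes "nonunits_share_divisor R"
  shows "coherent_ring R \<longleftrightarrow> divides_total R"
  using assms fg_intersections_if_coherent divides_total_if_fg_intersections
    coherent_if_divides_total by blast

section \<open>Valuation domains and finite conductor domains\<close>

lemma (in field) inv_div: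
  assumes "a \<in> carrier R - {\<zero>}" "b \<in> carrier R - {\<zero>}"
  shows "inv (a \<otimes> inv b) = b \<otimes> inv a"
proof -
  have a: "a \<in> carrier R" "inv a \<in> carrier R" "a \<otimes> inv a = \<one>"
    and b: "b \<in> carrier R" "inv b \<in> carrier R" "b \<otimes> inv b = \<one>"
    using assms field_Units by auto
  have "(a \<otimes> inv b) \<otimes> (b \<otimes> inv a) = (a \<otimes> inv a) \<otimes> (b \<otimes> inv b)"
    using a(1,2) b(1,2) by (simp add: m_ac)
  then show ?thesis using a b by (intro comm_inv_char) simp_all
qed

lemma (in field) valuation_domain_iff_divides_total:
  assumes S: "subdomain S R"
  shows "valuation_domain R S \<longleftrightarrow> divides_total (R \<lparr> carrier := S \<rparr>)"
proof -
  note E = subringE[OF subcring.axioms(1)[OF subdomain.axioms(1)[OF S]]]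
  have SR: "\<And>x. x \<in> S \<Longrightarrow> x \<in> carrier R" using E(1) by auto
  have U: "\<And>x. x \<in> carrier R \<Longrightarrow> x \<noteq> \<zero> \<Longrightarrow> x \<in> Units R" using field_Units by auto
  have dvd: "b divides\<^bsub>R\<lparr>carrier := S\<rparr>\<^esub> a \<longleftrightarrow> a \<otimes> inv b \<in> S"
    if "a \<in> S" "b \<in> S" "b \<noteq> \<zero>" for a b
  proof -
    have c: "a \<in> carrier R" "b \<in> carrier R" "inv b \<in> carrier R" "b \<otimes> inv b = \<one>"
      using that SR U by auto
    have "a = b \<otimes> (a \<otimes> inv b)" using c by (metis m_assoc m_comm r_one)
    moreover have "a \<otimes> inv b = x" if "x \<in> carrier R" "a = b \<otimes> x" for x
      using that c by (metis m_assoc m_comm m_closed l_one)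
    ultimately show ?thesis unfolding factor_def using SR by auto
  qed
  show ?thesis
  proof
    assume V: "valuation_domain R S"
    show "divides_total (R \<lparr> carrier := S \<rparr>)"
      unfolding divides_total_def
    proof (intro ballI)
      fix a b assume "a \<in> carrier (R\<lparr>carrier := S\<rparr>)" "b \<in> carrier (R\<lparr>carrier := S\<rparr>)"
      then have ab: "a \<in> S" "b \<in> S" by auto
      show "a divides\<^bsub>R\<lparr>carrier := S\<rparr>\<^esub> b \<or> b divides\<^bsub>R\<lparr>carrier := S\<rparr>\<^esub> a"
      proof (cases "a = \<zero> \<or> b = \<zero>")
        case True
        have "\<zero> = x \<otimes> \<zero>" if "x \<in> S" for x using SR[OF that] by simp
        then show ?thesis using True ab E(2) unfolding factor_def by fastforce
      next
        case False
        define q where "q = a \<otimes> inv b"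
        have "q \<in> quotient_field R S" unfolding quotient_field_def q_def using ab False by blast
        moreover have "q \<noteq> \<zero>"
        proof
          assume "q = \<zero>"
          have c: "a \<in> carrier R" "b \<in> carrier R" "inv b \<in> carrier R" "b \<otimes> inv b = \<one>"
            using False ab SR U by auto
          have "a = q \<otimes> b" unfolding q_def using c by (simp add: m_assoc m_comm[of "inv b" b])
          then show False using \<open>q = \<zero>\<close> False c by simp
        qed
        ultimately have "q \<in> S \<or> inv q \<in> S" using V unfolding valuation_domain_def by blast
        moreover have "inv q = b \<otimes> inv a" unfolding q_def using inv_div ab SR False by simp
        ultimately show ?thesis using dvd ab False unfolding q_def by auto
      qed
    qed
  next
    assume tot: "divides_total (R \<lparr> carrier := S \<rparr>)"
    show "valuation_domain R S"
      unfolding valuation_domain_def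
    proof (intro conjI ballI)
      show "subdomain S R" by (rule S)
      fix q assume "q \<in> quotient_field R S - {\<zero>}"
      then obtain a b where ab: "a \<in> S" "b \<in> S" "b \<noteq> \<zero>" "q = a \<otimes> inv b" "q \<noteq> \<zero>"
        unfolding quotient_field_def by auto
      have a0: "a \<noteq> \<zero>" using ab SR U by auto
      have "a divides\<^bsub>R\<lparr>carrier := S\<rparr>\<^esub> b \<or> b divides\<^bsub>R\<lparr>carrier := S\<rparr>\<^esub> a"
        using tot ab unfolding divides_total_def by simp
      then show "q \<in> S \<or> inv q \<in> S"
        using dvd ab a0 inv_div[of a b] SR by auto
    qed
  qed
qed

lemma (in field) fg_intersections_if_finite_conductor:
  assumes "finite_conductor_domain R S"
  shows "fg_intersections (R \<lparr> carrier := S \<rparr>)"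
  unfolding fg_intersections_def
proof (intro ballI)
  have S: "subdomain S R" using assms unfolding finite_conductor_domain_def by blast
  note sub = subcring.axioms(1)[OF subdomain.axioms(1)[OF S]]
  note E = subringE[OF sub]
  interpret D: domain "R \<lparr> carrier := S \<rparr>" using subdomain_is_domain[OF S] .
  fix a b assume "a \<in> carrier (R\<lparr>carrier := S\<rparr>)" "b \<in> carrier (R\<lparr>carrier := S\<rparr>)"
  then have ab: "a \<in> S" "b \<in> S" by auto
  have "x \<in> quotient_field R S" if "x \<in> S" for x
    unfolding quotient_field_def using that E(1,3)
    by (intro CollectI exI[of _ x] exI[of _ \<one>]) auto
  then have fg: "finitely_generated (R \<lparr> carrier := S \<rparr>) (sub_as_module R ((a <#\<^bsub>R\<^esub> S) \<inter> (b <#\<^bsub>R\<^esub> S)))"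
    using assms ab unfolding finite_conductor_domain_def by blast
  have eq: "x <#\<^bsub>R\<^esub> S = PIdl\<^bsub>R\<lparr>carrier := S\<rparr>\<^esub> x" if "x \<in> S" for x
    using that E(1) m_comm unfolding l_coset_def cgenideal_def by (auto; metis subsetD)
  have I: "ideal ((a <#\<^bsub>R\<^esub> S) \<inter> (b <#\<^bsub>R\<^esub> S)) (R \<lparr> carrier := S \<rparr>)"
    unfolding eq[OF ab(1)] eq[OF ab(2)] using ab
    by (intro D.i_intersect D.cgenideal_ideal) auto
  have "sub_as_module R B = sub_as_module (R \<lparr> carrier := S \<rparr>) B" for B
    by (simp add: sub_as_module_def)
  then show "\<exists>A\<subseteq>carrier (R\<lparr>carrier := S\<rparr>). finite A \<and>
      PIdl\<^bsub>R\<lparr>carrier := S\<rparr>\<^esub> a \<inter> PIdl\<^bsub>R\<lparr>carrier := S\<rparr>\<^esub> b = Idl\<^bsub>R\<lparr>carrier := S\<rparr>\<^esub> A"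
    using fg D.finitely_generated_ideal_iff[OF I] unfolding eq[OF ab(1)] eq[OF ab(2)] by metis
qed

lemma (in cring) finitely_generated_principal_fractional:
  assumes S: "subring S R" and c: "c \<in> carrier R"
  shows "finitely_generated (R \<lparr> carrier := S \<rparr>) (sub_as_module R (c <#\<^bsub>R\<^esub> S))"
  unfolding finitely_generated_def
proof (intro conjI exI[of _ "{c}"])
  note E = subringE[OF S]
  have SR: "\<And>x. x \<in> S \<Longrightarrow> x \<in> carrier R" using E(1) by auto
  have mem: "x \<in> c <#\<^bsub>R\<^esub> S \<longleftrightarrow> (\<exists>s \<in> S. x = c \<otimes> s)" for x
    by (auto simp: l_coset_def)
  show mod: "module (R \<lparr> carrier := S \<rparr>) (sub_as_module R (c <#\<^bsub>R\<^esub> S))"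
  proof (rule module_sub_as_module[OF is_cring S])
    show "c <#\<^bsub>R\<^esub> S \<subseteq> carrier R" using c SR mem by auto
    show "\<zero> \<in> c <#\<^bsub>R\<^esub> S" using c E(2) mem by (metis r_null)
    fix x y assume "x \<in> c <#\<^bsub>R\<^esub> S" "y \<in> c <#\<^bsub>R\<^esub> S"
    then obtain s t where "s \<in> S" "t \<in> S" "x = c \<otimes> s" "y = c \<otimes> t" unfolding mem by blast
    then show "x \<oplus> y \<in> c <#\<^bsub>R\<^esub> S" unfolding mem using E(7) SR c
      by (intro bexI[of _ "s \<oplus> t"]) (simp_all add: r_distr)
  next
    fix s x assume s: "s \<in> S" and "x \<in> c <#\<^bsub>R\<^esub> S"
    then obtain t where "t \<in> S" "x = c \<otimes> t" unfolding mem by blast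
    then show "s \<otimes> x \<in> c <#\<^bsub>R\<^esub> S" unfolding mem using s E(6) SR c
      by (intro bexI[of _ "s \<otimes> t"]) (simp_all add: m_lcomm)
  qed
  have cm: "c \<in> c <#\<^bsub>R\<^esub> S" using c E(3) mem by (metis r_one)
  show "{c} \<subseteq> carrier (sub_as_module R (c <#\<^bsub>R\<^esub> S))" using cm by (simp add: sub_as_module_def)
  show "finite {c}" by simp
  show "\<Inter>{N. submodule N (R\<lparr>carrier := S\<rparr>) (sub_as_module R (c <#\<^bsub>R\<^esub> S)) \<and> {c} \<subseteq> N} =
      carrier (sub_as_module R (c <#\<^bsub>R\<^esub> S))" (is "\<Inter>?X = _")
  proof
    show "\<Inter>?X \<subseteq> carrier (sub_as_module R (c <#\<^bsub>R\<^esub> S))"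
      using module.carrier_is_submodule[OF mod] cm by (intro Inter_lower) (auto simp: sub_as_module_def)
    show "carrier (sub_as_module R (c <#\<^bsub>R\<^esub> S)) \<subseteq> \<Inter>?X"
    proof (intro Inter_greatest subsetI)
      fix N x assume "N \<in> ?X" and "x \<in> carrier (sub_as_module R (c <#\<^bsub>R\<^esub> S))"
      then have N: "submodule N (R\<lparr>carrier := S\<rparr>) (sub_as_module R (c <#\<^bsub>R\<^esub> S))" "c \<in> N"
        and x: "x \<in> c <#\<^bsub>R\<^esub> S" by (auto simp: sub_as_module_def)
      obtain s where s: "s \<in> S" "x = c \<otimes> s" using x unfolding mem by blast
      have "s \<otimes> c \<in> N"
        using submodule.smult_closed[OF N(1) _ N(2), of s] s by (simp add: sub_as_module_def)
      then show "x \<in> N" using s SR c m_comm by simp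
    qed
  qed
qed

text \<open>Clearing denominators, totality of divisibility passes from \<open>S\<close> to its quotient field: of two
  fractions \<open>a, b\<close> one is an \<open>S\<close>-multiple of the other, so \<open>aS \<inter> bS\<close> is \<open>aS\<close> or \<open>bS\<close>.\<close>

lemma (in field) finite_conductor_if_divides_total:
  assumes S: "subdomain S R" and tot: "divides_total (R \<lparr> carrier := S \<rparr>)"
  shows "finite_conductor_domain R S"
  unfolding finite_conductor_domain_def
proof (intro conjI ballI)
  show "subdomain S R" by (rule S)
  note sub = subcring.axioms(1)[OF subdomain.axioms(1)[OF S]]
  note E = subringE[OF sub]
  have SR: "\<And>x. x \<in> S \<Longrightarrow> x \<in> carrier R" using E(1) by auto
  have U: "\<And>x. x \<in> carrier R \<Longrightarrow> x \<noteq> \<zero> \<Longrightarrow> x \<in> Units R" using field_Units by auto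
  have sub_coset: "(a \<otimes> s) <#\<^bsub>R\<^esub> S \<subseteq> a <#\<^bsub>R\<^esub> S" if "a \<in> carrier R" "s \<in> S" for a s
  proof
    fix w assume "w \<in> (a \<otimes> s) <#\<^bsub>R\<^esub> S"
    then obtain t where "t \<in> S" "w = a \<otimes> s \<otimes> t" unfolding l_coset_def by blast
    then have "w = a \<otimes> (s \<otimes> t)" "s \<otimes> t \<in> S" using that SR E(6) by (simp_all add: m_assoc)
    then show "w \<in> a <#\<^bsub>R\<^esub> S" unfolding l_coset_def by blast
  qed
  have cmp: "y \<otimes> inv v = (x \<otimes> inv u) \<otimes> s"
    if "x \<in> S" "u \<in> S" "u \<noteq> \<zero>" "y \<in> S" "v \<in> S" "v \<noteq> \<zero>" "s \<in> S"
      "y \<otimes> u = x \<otimes> v \<otimes> s" for x u y v s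
  proof -
    note c = that(1,2,4,5,7)[THEN SR]
    have i: "inv u \<in> carrier R" "inv v \<in> carrier R" "u \<otimes> inv u = \<one>" "v \<otimes> inv v = \<one>"
      using that c U by auto
    have "y \<otimes> inv v = y \<otimes> inv v \<otimes> (u \<otimes> inv u)" using c i by simp
    also have "\<dots> = (y \<otimes> u) \<otimes> (inv u \<otimes> inv v)" using c i(1,2) by (simp add: m_ac)
    also have "\<dots> = (x \<otimes> v \<otimes> s) \<otimes> (inv u \<otimes> inv v)" using that by simp
    also have "\<dots> = (x \<otimes> inv u) \<otimes> s \<otimes> (v \<otimes> inv v)" using c i(1,2) by (simp add: m_ac)
    also have "\<dots> = (x \<otimes> inv u) \<otimes> s" using c i by simp
    finally show ?thesis .
  qed
  fix a b assume "a \<in> quotient_field R S" "b \<in> quotient_field R S"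
  then obtain x u y v where xu: "x \<in> S" "u \<in> S" "u \<noteq> \<zero>" "a = x \<otimes> inv u"
    and yv: "y \<in> S" "v \<in> S" "v \<noteq> \<zero>" "b = y \<otimes> inv v"
    unfolding quotient_field_def by blast
  have ab: "a \<in> carrier R" "b \<in> carrier R" using xu yv SR U by auto
  have "x \<otimes> v \<in> S" "y \<otimes> u \<in> S" using xu yv E(6) by auto
  then consider s where "s \<in> S" "y \<otimes> u = x \<otimes> v \<otimes> s" | s where "s \<in> S" "x \<otimes> v = y \<otimes> u \<otimes> s"
    using tot unfolding divides_total_def factor_def by force
  then show "finitely_generated (R\<lparr>carrier := S\<rparr>) (sub_as_module R ((a <#\<^bsub>R\<^esub> S) \<inter> (b <#\<^bsub>R\<^esub> S)))"
  proof cases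
    case 1
    then have "b = a \<otimes> s" using cmp[of x u y v s] xu yv by simp
    then have "(a <#\<^bsub>R\<^esub> S) \<inter> (b <#\<^bsub>R\<^esub> S) = b <#\<^bsub>R\<^esub> S" using sub_coset ab 1 by blast
    then show ?thesis using finitely_generated_principal_fractional[OF sub ab(2)] by simp
  next
    case 2
    then have "a = b \<otimes> s" using cmp[of y v x u s] xu yv by simp
    then have "(a <#\<^bsub>R\<^esub> S) \<inter> (b <#\<^bsub>R\<^esub> S) = a <#\<^bsub>R\<^esub> S" using sub_coset ab 2 by blast
    then show ?thesis using finitely_generated_principal_fractional[OF sub ab(1)] by simp
  qed
qed

section \<open>Local quadratic transforms\<close>

lemma max_ideal_maximal:
  assumes "local_ring R"
  shows "maximalideal (max_ideal R) R"
  unfolding max_ideal_def using assms theI'[of "\<lambda>M. maximalideal M R"] by (simp add: local_ring_def)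

lemma (in noetherian_ring) exists_maximalideal:
  assumes I: "ideal I R" "I \<noteq> carrier R"
  shows "\<exists>M. maximalideal M R \<and> I \<subseteq> M"
proof -
  define P where "P = {J. ideal J R \<and> J \<noteq> carrier R \<and> I \<subseteq> J}"
  have "\<exists>M\<in>P. \<forall>J\<in>P. M \<subseteq> J \<longrightarrow> J = M"
  proof (rule subset_Zorn_nonempty)
    show "P \<noteq> {}" using I by (auto simp: P_def)
    fix C assume C: "C \<noteq> {}" "subset.chain P C"
    have "subset.chain {J. ideal J R} C"
      using C(2) by (auto simp: subset.chain_def P_def)
    then have "\<Union>C \<in> C" using ideal_chain_is_trivial[OF C(1)] by simp
    then show "\<Union>C \<in> P" using C(2) by (auto simp: subset.chain_def)
  qed
  then obtain M where M: "M \<in> P" "\<And>J. J \<in> P \<Longrightarrow> M \<subseteq> J \<Longrightarrow> J = M" by blast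
  have "maximalideal M R"
    using M by (intro maximalidealI) (auto simp: P_def)
  then show ?thesis using M(1) by (auto simp: P_def)
qed

lemma nonunit_in_max_ideal:
  fixes R (structure)
  assumes "local_ring R" "noetherian_ring R" "x \<in> carrier R - Units R"
  shows "x \<in> max_ideal R"
proof -
  interpret noetherian_ring R by fact
  interpret cring R using assms(1) by (simp add: local_ring_def)
  have x: "x \<in> carrier R" using assms(3) by simp
  have "PIdl x \<noteq> carrier R"
  proof
    assume "PIdl x = carrier R"
    then obtain y where "y \<in> carrier R" "\<one> = y \<otimes> x" unfolding cgenideal_def using one_closed by blast
    then have "x \<in> Units R" using x m_comm[of x y] by (auto simp: Units_def)
    then show False using assms(3) by simp
  qed
  then obtain M where "maximalideal M R" "PIdl x \<subseteq> M"
    using exists_maximalideal[OF cgenideal_ideal[OF x]] by blast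
  moreover have "M = max_ideal R"
    using assms(1) max_ideal_maximal[OF assms(1)] calculation(1) unfolding local_ring_def by blast
  ultimately show ?thesis using cgenideal_self[OF x] by blast
qed

text \<open>Every \<open>y\<close> in the maximal ideal of \<open>A\<close> is \<open>x (y/x)\<close> with \<open>y/x\<close> in the blowup chart. The chart
  lies in \<open>V\<close>, because \<open>\<mm>V = xV\<close>. If \<open>x\<close> had an inverse \<open>c/s\<close> in \<open>B\<close>, then \<open>s = c x\<close> would lie in
  the maximal ideal of \<open>V\<close>, which the denominators of \<open>B\<close> avoid.\<close>

lemma (in field) lqt_divisor:
  assumes "is_lqt R A B"
  obtains x where "A \<subseteq> B" and "x \<in> B - Units (R \<lparr> carrier := B \<rparr>)"
    and "\<And>y. y \<in> A - Units (R \<lparr> carrier := A \<rparr>) \<Longrightarrow> \<exists>c \<in> B. y = x \<otimes> c"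
proof -
  obtain V x where A: "local_domain R A" "noetherian_ring (R \<lparr> carrier := A \<rparr>)"
    and dom: "birationally_dominates R V A"
    and x: "x \<in> max_ideal_of R A" "x \<noteq> \<zero>"
    and Vx: "Idl\<^bsub>R \<lparr> carrier := V \<rparr>\<^esub> (max_ideal_of R A) = PIdl\<^bsub>R \<lparr> carrier := V \<rparr>\<^esub> x"
    and B: "B = localization_at R (blowup_chart R A x) (max_ideal_of R V \<inter> blowup_chart R A x)"
    using assms unfolding is_lqt_def is_lqt_along_def by blast
  define mA where "mA = max_ideal_of R A"
  define mV where "mV = max_ideal_of R V"
  define C where "C = blowup_chart R A x"
  have V: "local_domain R V" "A \<subseteq> V" "mA \<subseteq> mV"
    using dom unfolding birationally_dominates_def mA_def mV_def by auto
  have subA: "subring A R" and subV: "subring V R" and domV: "subdomain V R"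
    using A(1) V(1) unfolding local_domain_def subdomain_def subcring_def by auto
  note EA = subringE[OF subA] and EV = subringE[OF subV]
  interpret RV: domain "R \<lparr> carrier := V \<rparr>" using subdomain_is_domain[OF domV] .
  have maxA: "maximalideal mA (R \<lparr> carrier := A \<rparr>)" and maxV: "maximalideal mV (R \<lparr> carrier := V \<rparr>)"
    using A(1) V(1) max_ideal_maximal unfolding local_domain_def mA_def mV_def by auto
  interpret mV: maximalideal mV "R \<lparr> carrier := V \<rparr>" by (rule maxV)
  have mAA: "mA \<subseteq> A" using ideal.Icarr[OF maximalideal.axioms(1)[OF maxA]] by auto
  have one_mV: "\<one> \<notin> mV" using mV.one_imp_carrier mV.I_notcarr by auto
  have zero_mV: "\<zero> \<in> mV" using mV.zero_closed by simp
  have xA: "x \<in> A" and xR: "x \<in> carrier R" using x(1) mAA EA(1) unfolding mA_def by auto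
  have xu: "inv x \<in> carrier R" "x \<otimes> inv x = \<one>" using x(2) xR field_Units by auto
  have frac: "y \<otimes> inv x \<in> V" if y: "y \<in> mA" for y
  proof -
    have "y \<in> Idl\<^bsub>R \<lparr> carrier := V \<rparr>\<^esub> mA" using y unfolding genideal_def by blast
    then obtain v where v: "v \<in> V" "y = v \<otimes> x"
      using Vx unfolding mA_def cgenideal_def by auto
    then have "y \<otimes> inv x = v" using EV(1) xR xu by (auto simp: m_assoc)
    then show ?thesis using v(1) by simp
  qed
  have fracR: "{y \<otimes> inv x | y. y \<in> mA} \<subseteq> carrier R" using frac EV(1) by auto
  have gen: "A \<union> {y \<otimes> inv x | y. y \<in> mA} \<subseteq> carrier R" using fracR EA(1) by auto
  have CV: "C \<subseteq> V"
    unfolding C_def blowup_chart_def mA_def[symmetric]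
    using generate_ring_min_subring1[OF gen subV] V(2) frac by auto
  have Cgen: "A \<subseteq> C" "\<And>y. y \<in> mA \<Longrightarrow> y \<otimes> inv x \<in> C"
    unfolding C_def blowup_chart_def mA_def[symmetric] by (auto intro!: generate_ring.incl)
  have oneC: "\<one> \<in> C" unfolding C_def blowup_chart_def by (rule generate_ring.one)
  have B': "B = {a \<otimes> inv s | a s. a \<in> C \<and> s \<in> C - mV}"
    unfolding B localization_at_def C_def mV_def by auto
  have CR: "C \<subseteq> carrier R" using CV EV(1) by auto
  have CB: "C \<subseteq> B"
  proof
    fix a assume a: "a \<in> C"
    then have "a = a \<otimes> inv \<one>" using CR by auto
    then show "a \<in> B" unfolding B' using a oneC one_mV by blast
  qed
  show thesis
  proof (rule that)
    show "A \<subseteq> B" using Cgen(1) CB by auto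
    have "x \<notin> Units (R \<lparr> carrier := B \<rparr>)"
    proof
      assume "x \<in> Units (R \<lparr> carrier := B \<rparr>)"
      then obtain w where "w \<in> B" "w \<otimes> x = \<one>" unfolding Units_def by auto
      then obtain a s where as: "a \<in> C" "s \<in> C" "s \<notin> mV" "a \<otimes> inv s \<otimes> x = \<one>"
        unfolding B' by auto
      have sU: "s \<in> Units R" using as(2,3) CR zero_mV field_Units by auto
      then have s: "s \<in> carrier R" "inv s \<in> carrier R" "inv s \<otimes> s = \<one>"
        using Units_closed by auto
      have aR: "a \<in> carrier R" using as(1) CR by auto
      have "s = (a \<otimes> inv s \<otimes> x) \<otimes> s" using s as(4) by simp
      also have "\<dots> = a \<otimes> x \<otimes> (inv s \<otimes> s)" using s(1,2) aR xR by (simp add: m_ac)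
      also have "\<dots> = a \<otimes> x" using s aR xR by simp
      finally have "s = a \<otimes> x" .
      moreover have "a \<otimes> x \<in> mV"
        using mV.I_l_closed[of x a] x(1) V(3) as(1) CV unfolding mA_def by auto
      ultimately show False using as(3) by simp
    qed
    then show "x \<in> B - Units (R \<lparr> carrier := B \<rparr>)" using xA Cgen(1) CB by auto
    fix y assume y: "y \<in> A - Units (R \<lparr> carrier := A \<rparr>)"
    have yA: "y \<in> mA"
      unfolding mA_def using nonunit_in_max_ideal[of "R \<lparr> carrier := A \<rparr>" y] A y
      unfolding local_domain_def by auto
    have "y = x \<otimes> (y \<otimes> inv x)"
    proof -
      have "y \<in> carrier R" using yA mAA EA(1) by auto
      then have "x \<otimes> (y \<otimes> inv x) = y \<otimes> (x \<otimes> inv x)" using xR xu(1) by (simp add: m_lcomm)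
      then show ?thesis using \<open>y \<in> carrier R\<close> xu(2) by simp
    qed
    then show "\<exists>c\<in>B. y = x \<otimes> c" using Cgen(2)[OF yA] CB by auto
  qed
qed

text \<open>A nonunit of \<open>R\<^sub>n\<close> is a multiple of \<open>x\<^sub>n\<close> in \<open>R\<^sub>n\<^sub>+\<^sub>1\<close>, hence again a nonunit there, and so on up the
  chain. Therefore \<open>x\<^sub>n\<close> remains a nonunit in the union, where it divides all nonunits of \<open>R\<^sub>n\<close>.\<close>

lemma (in field) shannon_nonunits_share_divisor:
  assumes "quadratic_shannon_extension R A S"
  shows "subdomain S R" and "nonunits_share_divisor (R \<lparr> carrier := S \<rparr>)"
proof -
  obtain Rs :: "nat \<Rightarrow> 'a set" where sub: "\<And>n. subdomain (Rs n) R"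
    and lqt: "\<And>n. is_lqt R (Rs n) (Rs (Suc n))" and S: "S = (\<Union>n. Rs n)"
    using assms unfolding quadratic_shannon_extension_def by blast
  have "\<forall>n. \<exists>x. Rs n \<subseteq> Rs (Suc n) \<and> x \<in> Rs (Suc n) - Units (R \<lparr> carrier := Rs (Suc n) \<rparr>) \<and>
      (\<forall>y \<in> Rs n - Units (R \<lparr> carrier := Rs n \<rparr>). \<exists>c \<in> Rs (Suc n). y = x \<otimes> c)"
    using lqt_divisor[OF lqt] by metis
  then obtain x where step: "\<And>n. Rs n \<subseteq> Rs (Suc n)"
    and x: "\<And>n. x n \<in> Rs (Suc n) - Units (R \<lparr> carrier := Rs (Suc n) \<rparr>)"
    and xd: "\<And>n y. y \<in> Rs n - Units (R \<lparr> carrier := Rs n \<rparr>) \<Longrightarrow> \<exists>c \<in> Rs (Suc n). y = x n \<otimes> c"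
    by metis
  have E: "subring (Rs n) R" for n
    using sub[of n] unfolding subdomain_def subcring_def by blast
  note E = subringE[OF E]
  have mono: "Rs m \<subseteq> Rs n" if "m \<le> n" for m n
    using lift_Suc_mono_le[of Rs, OF step that] .
  have common: "\<exists>n. a \<in> Rs n \<and> b \<in> Rs n" if ab: "a \<in> S" "b \<in> S" for a b
  proof -
    obtain m n where "a \<in> Rs m" "b \<in> Rs n" using ab unfolding S by blast
    then show ?thesis using mono[of m "max m n"] mono[of n "max m n"] by auto
  qed
  have SR: "S \<subseteq> carrier R" using E(1) S by auto
  have subS: "subring S R"
  proof (rule subringI[OF SR])
    show "\<one> \<in> S" using E(3) S by auto
    show "\<ominus> h \<in> S" if "h \<in> S" for h using that E(5) S by auto
    fix h k assume "h \<in> S" "k \<in> S"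
    then obtain n where n: "h \<in> Rs n" "k \<in> Rs n" using common by blast
    show "h \<otimes> k \<in> S" "h \<oplus> k \<in> S" using E(6)[OF n] E(7)[OF n] S by auto
  qed
  then show "subdomain S R" by (rule subdomainI')
  have unit: "u \<in> Units (R \<lparr> carrier := D \<rparr>) \<longleftrightarrow> u \<in> D \<and> (\<exists>w \<in> D. w \<otimes> u = \<one>)"
    if "D \<subseteq> carrier R" for u D
    using that m_comm by (auto simp: Units_def subset_iff)
  have keep: "y \<notin> Units (R \<lparr> carrier := Rs m \<rparr>)"
    if "y \<in> Rs n - Units (R \<lparr> carrier := Rs n \<rparr>)" "n \<le> m" for y n m
    using that(2)
  proof (induction m rule: dec_induct)
    case base
    then show ?case using that(1) by simp
  next
    case (step m)
    have "y \<in> Rs m" using that(1) mono[OF step.hyps(1)] by auto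
    then obtain c where c: "c \<in> Rs (Suc m)" "y = x m \<otimes> c" using step.IH xd by blast
    show ?case
    proof
      assume "y \<in> Units (R \<lparr> carrier := Rs (Suc m) \<rparr>)"
      then obtain w where w: "w \<in> Rs (Suc m)" "w \<otimes> y = \<one>" using unit[OF E(1)] by blast
      have "(w \<otimes> c) \<otimes> x m = \<one>"
        using w c x[of m] E(1)[of "Suc m"] by (metis DiffD1 m_assoc m_comm subsetD)
      then have "x m \<in> Units (R \<lparr> carrier := Rs (Suc m) \<rparr>)"
        using unit[OF E(1)] x[of m] E(6)[OF w(1) c(1)] by blast
      then show False using x[of m] by simp
    qed
  qed
  have nonunit: "y \<notin> Units (R \<lparr> carrier := S \<rparr>)"
    if y: "y \<in> Rs n - Units (R \<lparr> carrier := Rs n \<rparr>)" for y n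
  proof
    assume "y \<in> Units (R \<lparr> carrier := S \<rparr>)"
    then obtain w where w: "w \<in> S" "w \<otimes> y = \<one>" using unit[OF SR] by blast
    then obtain k where "w \<in> Rs k" using S by auto
    then have "w \<in> Rs (max n k)" "y \<in> Rs (max n k)"
      using mono[of k "max n k"] mono[of n "max n k"] y by auto
    then have "y \<in> Units (R \<lparr> carrier := Rs (max n k) \<rparr>)" using unit[OF E(1)] w(2) by blast
    then show False using keep[OF y, of "max n k"] by simp
  qed
  show "nonunits_share_divisor (R \<lparr> carrier := S \<rparr>)"
    unfolding nonunits_share_divisor_def
  proof (intro ballI)
    fix a b
    assume a: "a \<in> carrier (R\<lparr>carrier := S\<rparr>) - Units (R\<lparr>carrier := S\<rparr>)"
      and b: "b \<in> carrier (R\<lparr>carrier := S\<rparr>) - Units (R\<lparr>carrier := S\<rparr>)"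
    then obtain n where n: "a \<in> Rs n" "b \<in> Rs n" using common[of a b] by auto
    have sub: "u \<in> Units (R\<lparr>carrier := S\<rparr>)" if "u \<in> Units (R\<lparr>carrier := Rs n\<rparr>)" for u
    proof -
      obtain w where "w \<in> Rs n" "w \<otimes> u = \<one>" "u \<in> Rs n"
        using \<open>u \<in> Units (R\<lparr>carrier := Rs n\<rparr>)\<close> unit[OF E(1)] by blast
      then show ?thesis using unit[OF SR, of u] S by auto
    qed
    have "a \<in> Rs n - Units (R\<lparr>carrier := Rs n\<rparr>)" "b \<in> Rs n - Units (R\<lparr>carrier := Rs n\<rparr>)"
      using a b n sub by auto
    then obtain c d where "c \<in> Rs (Suc n)" "a = x n \<otimes> c" "d \<in> Rs (Suc n)" "b = x n \<otimes> d"
      using xd by meson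
    then have "x n divides\<^bsub>R\<lparr>carrier := S\<rparr>\<^esub> a" "x n divides\<^bsub>R\<lparr>carrier := S\<rparr>\<^esub> b"
      using S unfolding factor_def by auto
    moreover have "x n \<in> carrier (R\<lparr>carrier := S\<rparr>) - Units (R\<lparr>carrier := S\<rparr>)"
      using x[of n] nonunit[OF x] S by auto
    ultimately show "\<exists>z \<in> carrier (R\<lparr>carrier := S\<rparr>) - Units (R\<lparr>carrier := S\<rparr>).
        z divides\<^bsub>R\<lparr>carrier := S\<rparr>\<^esub> a \<and> z divides\<^bsub>R\<lparr>carrier := S\<rparr>\<^esub> b" by blast
  qed
qed

section \<open>The equivalence\<close>

theorem theorem6p2:
  fixes F :: "('a, 'b) ring_scheme" and R S :: "'a set"
  assumes "field F"
    and "subring R F"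
    and "regular_local_ring (F \<lparr> carrier := R \<rparr>)"
    and "quadratic_shannon_extension F R S"
  shows "(coherent_ring (F \<lparr> carrier := S \<rparr>) \<longleftrightarrow> gcd_domain (F \<lparr> carrier := S \<rparr>)) \<and>
         (gcd_domain (F \<lparr> carrier := S \<rparr>) \<longleftrightarrow> finite_conductor_domain F S) \<and>
         (finite_conductor_domain F S \<longleftrightarrow> valuation_domain F S)"
proof -
  interpret field F by fact
  have S: "subdomain S F" and share: "nonunits_share_divisor (F \<lparr> carrier := S \<rparr>)"
    using shannon_nonunits_share_divisor[OF assms(4)] by auto
  interpret D: domain "F \<lparr> carrier := S \<rparr>" using subdomain_is_domain[OF S] .
  let ?total = "divides_total (F \<lparr> carrier := S \<rparr>)"
  have "coherent_ring (F \<lparr> carrier := S \<rparr>) \<longleftrightarrow> ?total"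
    by (rule D.coherent_iff_divides_total[OF share])
  moreover have "gcd_domain (F \<lparr> carrier := S \<rparr>) \<longleftrightarrow> ?total"
    by (rule D.gcd_domain_iff_divides_total[OF share])
  moreover have "finite_conductor_domain F S \<longleftrightarrow> ?total"
    using fg_intersections_if_finite_conductor D.divides_total_if_fg_intersections[OF share]
      finite_conductor_if_divides_total[OF S] by blast
  moreover have "valuation_domain F S \<longleftrightarrow> ?total"
    by (rule valuation_domain_iff_divides_total[OF S])
  ultimately show ?thesis by blast
qed

end
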